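(* Consider the symmetric hyperbolic system $$u_t+Au_x+Bu_y=0,\quad (x,y)\in\Omega=[0,1]^2,\ t>0,\qquad u(x,y,0)=f(x,y),$$ with characteristic boundary conditions $\bigl([Q_I^{(i)}]^T-S_i[Q_{II}^{(i)}]^T\bigr)u=0$ for $(x,y)\in\Gamma_i$, $t>0$, $i=1,\dots,4$. The semidiscrete system $$v_t+P(AD_x+BD_y)Pv=0,\quad t>0,\qquad v(0)=f,\quad f=Pf,$$ with $P=I-L^+L$ and $L$ the discrete boundary operator representing these boundary conditions, is a strictly stable approximation of this initial-boundary value problem.
   Context: $A,B\in\mathbb{R}^{d\times d}$ are constant symmetric matrices. The initial-boundary value problem is assumed to be semibounded, and hence well posed in the sense of an energy estimate. $\Gamma_1,\Gamma_2,\Gamma_3,\Gamma_4$ are the sides $y=0$, $x=1$, $y=1$, $x=0$ of the unit square. $Q^{(1)}=Q^{(3)}$ is an orthogonal matrix of eigenvectors diagonalizing $B$, and $Q^{(2)}=Q^{(4)}$ is an orthogonal matrix of eigenvectors diagonalizing $A$. For each $i$, the columns of $Q_I^{(i)}\in\mathbb{R}^{d\times d_1^{(i)}}$ are the eigenvectors representing the $d_1^{(i)}$ (locally) ingoing characteristics on $\Gamma_i$, and the columns of $Q_{II}^{(i)}\in\mathbb{R}^{d\times(d-d_1^{(i)})}$ are the remaining eigenvectors, corresponding to the outgoing ones; $S_i\in\mathbb{R}^{d_1^{(i)}\times(d-d_1^{(i)})}$. Grid: $(ih_1,jh_2)$, $h_1=1/N_1$, $h_2=1/N_2$, $0\le i\le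 N_1$, $0\le j\le N_2$, with $v_{ij}\in\mathbb{R}^d$; grid vectors are row-ordered ($i$ inner, $j$ outer). $H_1,H_2$ are symmetric positive definite matrices (not necessarily diagonal) of sizes $N_1+1$ and $N_2+1$, and $D_1,D_2$ are one-dimensional consistent difference operators satisfying summation by parts with respect to them: $a^TH_lD_lb=a_{N_l}b_{N_l}-a_0b_0-(D_la)^TH_lb$ for all $a,b\in\mathbb{R}^{N_l+1}$, $l=1,2$. The state space $V=\mathbb{R}^{(N_1+1)(N_2+1)d}$ has inner product $(u,v)=u^T(H_2\otimes H_1\otimes I_d)v$, where $I_d$ is the $d\times d$ identity. With $I_1,I_2$ the identities of sizes $N_1+1,N_2+1$: $D_x=I_2\otimes D_1\otimes I_d$, $D_y=D_2\otimes I_1\otimes I_d$, and $A,B$ in the semidiscrete system denote the block diagonal matrices $I_2\otimes I_1\otimes A$, $I_2\otimes I_1\otimes B$. The discrete boundary operator is $L=(L_1;L_2;L_3;L_4)$ (stacked blocks), where, with $M_i=[Q_I^{(i)}]^T-S_i[Q_{II}^{(i)}]^T$ (padded with zero rows so as to be $d\times d$), $L_1=I_2[0,:]\otimes I_1\otimes M_1$, $L_2=I_2\otimes I_1[N_1,:]\otimes M_2$, $L_3=I_2[N_2,:]\otimes I_1\otimes M_3$, $L_4=I_2\otimes I_1[0,:]\otimes M_4$, and $I[k,:]$ denotes row $k$ of $I$ (rows counted from $0$). It maps $V$ into the boundary space $V_{\Gamma_+}=\mathbb{R}^{2(N_1+N_2+2)d}$, in which the four corner points are counted twice, with the inner product given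 by the block diagonal matrix with blocks $H_1\otimes I_d$, $H_2\otimes I_d$, $J_1H_1J_1\otimes I_d$, $J_2H_2J_2\otimes I_d$, where $J_l$ is the anti-diagonal permutation matrix of size $N_l+1$. $L^+$ is the Moore–Penrose pseudoinverse of $L:V\to V_{\Gamma_+}$: $LL^+L=L$, $L^+LL^+=L^+$, with $L^+L$ and $LL^+$ self-adjoint in $V$ and $V_{\Gamma_+}$ respectively. *)

theory Defs
  imports
    "HOL-Analysis.Henstock_Kurzweil_Integration"
    "Jordan_Normal_Form.DL_Submatrix"
begin

unbundle no inner_syntax

section \<open>The initial-boundary value problem on the unit square\<close>

text \<open>The sides \<open>South\<close>, \<open>East\<close>, \<open>North\<close>, \<open>West\<close> are \<open>\<Gamma>\<^sub>1\<close> (\<open>y = 0\<close>), \<open>\<Gamma>\<^sub>2\<close> (\<open>x = 1\<close>),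
  \<open>\<Gamma>\<^sub>3\<close> (\<open>y = 1\<close>) and \<open>\<Gamma>\<^sub>4\<close> (\<open>x = 0\<close>).\<close>

datatype side = South | East | North | West

fun side_points :: "side \<Rightarrow> (real \<times> real) set" where
  "side_points South = {0..1} \<times> {0}"
| "side_points East  = {1} \<times> {0..1}"
| "side_points North = {0..1} \<times> {1}"
| "side_points West  = {0} \<times> {0..1}"

text \<open>The symbol \<open>n\<^sub>x A + n\<^sub>y B\<close> for the outward unit normal \<open>n\<close>; a characteristic is ingoing
  if its eigenvalue is negative.\<close>

fun normal_mat :: "real mat \<Rightarrow> real mat \<Rightarrow> side \<Rightarrow> real mat" where
  "normal_mat A B South = - B"
| "normal_mat A B East  = A"
| "normal_mat A B North = B"
| "normal_mat A B West  = - A"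

definition symmetric_mat :: "nat \<Rightarrow> real mat \<Rightarrow> bool" where
  "symmetric_mat n X \<longleftrightarrow> X \<in> carrier_mat n n \<and> X\<^sup>T = X"

definition orthogonally_diagonalizes :: "nat \<Rightarrow> real mat \<Rightarrow> real mat \<Rightarrow> bool" where
  "orthogonally_diagonalizes n Q X \<longleftrightarrow>
     Q \<in> carrier_mat n n \<and> Q\<^sup>T * Q = 1\<^sub>m n \<and> diagonal_mat (Q\<^sup>T * X * Q)"

definition ingoing :: "real mat \<Rightarrow> real mat \<Rightarrow> nat set" where
  "ingoing X Q = {k. k < dim_col Q \<and> (Q\<^sup>T * X * Q) $$ (k, k) < 0}"

definition Q_in :: "real mat \<Rightarrow> real mat \<Rightarrow> real mat" where
  "Q_in X Q = submatrix Q UNIV (ingoing X Q)"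

definition Q_out :: "real mat \<Rightarrow> real mat \<Rightarrow> real mat" where
  "Q_out X Q = submatrix Q UNIV (- ingoing X Q)"

definition char_bc :: "real mat \<Rightarrow> real mat \<Rightarrow> real mat \<Rightarrow> real mat" where
  "char_bc X Q S = (Q_in X Q)\<^sup>T - S * (Q_out X Q)\<^sup>T"

text \<open>The boundary matrices of all four sides, \<open>d\<^sub>1 \<times> d\<close> on each side.\<close>

definition side_bc ::
  "real mat \<Rightarrow> real mat \<Rightarrow> (side \<Rightarrow> real mat) \<Rightarrow> (side \<Rightarrow> real mat) \<Rightarrow> side \<Rightarrow> real mat"
where
  "side_bc A B Q S = (\<lambda>s. char_bc (normal_mat A B s) (Q s) (S s))"

definition num_ingoing :: "real mat \<Rightarrow> real mat \<Rightarrow> (side \<Rightarrow> real mat) \<Rightarrow> side \<Rightarrow> nat" where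
  "num_ingoing A B Q s = card (ingoing (normal_mat A B s) (Q s))"

definition unit_square :: "(real \<times> real) set" where
  "unit_square = {0..1} \<times> {0..1}"

text \<open>\<open>u\<close> is continuously differentiable up to the boundary of the square, with partial
  derivatives \<open>ux\<close> and \<open>uy\<close> (one-sided where necessary).\<close>

definition C1_square ::
  "nat \<Rightarrow> (real \<times> real \<Rightarrow> real vec) \<Rightarrow> (real \<times> real \<Rightarrow> real vec) \<Rightarrow> (real \<times> real \<Rightarrow> real vec) \<Rightarrow> bool"
where
  "C1_square d u ux uy \<longleftrightarrow>
     (\<forall>p \<in> unit_square. u p \<in> carrier_vec d \<and> ux p \<in> carrier_vec d \<and> uy p \<in> carrier_vec d) \<and>
     (\<forall>k < d.
        continuous_on unit_square (\<lambda>p. u p $ k) \<and>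
        continuous_on unit_square (\<lambda>p. ux p $ k) \<and>
        continuous_on unit_square (\<lambda>p. uy p $ k) \<and>
        (\<forall>x \<in> {0..1}. \<forall>y \<in> {0..1}.
           ((\<lambda>s. u (s, y) $ k) has_real_derivative ux (x, y) $ k) (at x within {0..1}) \<and>
           ((\<lambda>s. u (x, s) $ k) has_real_derivative uy (x, y) $ k) (at y within {0..1})))"

definition L2_inner :: "(real \<times> real \<Rightarrow> real vec) \<Rightarrow> (real \<times> real \<Rightarrow> real vec) \<Rightarrow> real" where
  "L2_inner u w = integral unit_square (\<lambda>p. u p \<bullet> w p)"

text \<open>The energy estimate \<open>d/dt (u,u) \<le> 2 \<alpha> (u,u)\<close> of \<open>u\<^sub>t = - A u\<^sub>x - B u\<^sub>y\<close>, i.e.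
  semiboundedness with constant \<open>\<alpha>\<close>: it is required of every \<open>u\<close> satisfying the boundary
  conditions \<open>bc s u = 0\<close>.\<close>

definition energy_rate ::
  "nat \<Rightarrow> real mat \<Rightarrow> real mat \<Rightarrow> (side \<Rightarrow> real mat) \<Rightarrow> real \<Rightarrow> bool"
where
  "energy_rate d A B bc \<alpha> \<longleftrightarrow>
     (\<forall>u ux uy. C1_square d u ux uy \<longrightarrow>
        (\<forall>s. \<forall>p \<in> side_points s. bc s *\<^sub>v u p = 0\<^sub>v (dim_row (bc s))) \<longrightarrow>
        L2_inner u (\<lambda>p. - (A *\<^sub>v ux p + B *\<^sub>v uy p)) \<le> \<alpha> * L2_inner u u)"

definition semibounded :: "nat \<Rightarrow> real mat \<Rightarrow> real mat \<Rightarrow> (side \<Rightarrow> real mat) \<Rightarrow> bool" where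
  "semibounded d A B bc \<longleftrightarrow> (\<exists>\<alpha>. energy_rate d A B bc \<alpha>)"

section \<open>Weighted inner products and the pseudoinverse\<close>

definition spd :: "nat \<Rightarrow> real mat \<Rightarrow> bool" where
  "spd n H \<longleftrightarrow> symmetric_mat n H \<and> (\<forall>a \<in> carrier_vec n. a \<noteq> 0\<^sub>v n \<longrightarrow> a \<bullet> (H *\<^sub>v a) > 0)"

definition weighted_norm :: "real mat \<Rightarrow> real vec \<Rightarrow> real" where
  "weighted_norm G v = sqrt (v \<bullet> (G *\<^sub>v v))"

definition self_adjoint_wrt :: "real mat \<Rightarrow> real mat \<Rightarrow> bool" where
  "self_adjoint_wrt G T \<longleftrightarrow>
     (\<forall>u \<in> carrier_vec (dim_row G). \<forall>v \<in> carrier_vec (dim_row G).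
        (T *\<^sub>v u) \<bullet> (G *\<^sub>v v) = u \<bullet> (G *\<^sub>v (T *\<^sub>v v)))"

text \<open>\<open>X\<close> is the Moore--Penrose pseudoinverse of \<open>L\<close> for the Gram matrices \<open>G\<close> of the domain
  and \<open>G'\<close> of the codomain.\<close>

definition is_pseudoinverse :: "real mat \<Rightarrow> real mat \<Rightarrow> real mat \<Rightarrow> real mat \<Rightarrow> bool" where
  "is_pseudoinverse G G' L X \<longleftrightarrow>
     X \<in> carrier_mat (dim_col L) (dim_row L) \<and>
     L * X * L = L \<and> X * L * X = X \<and>
     self_adjoint_wrt G (X * L) \<and> self_adjoint_wrt G' (L * X)"

section \<open>One-dimensional difference operators\<close>

text \<open>\<open>H N\<close> and \<open>D N\<close> belong to the grid \<open>0, 1/N, \<dots>, 1\<close>.\<close>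

definition sbp :: "nat \<Rightarrow> real mat \<Rightarrow> real mat \<Rightarrow> bool" where
  "sbp N H D \<longleftrightarrow>
     (\<forall>a \<in> carrier_vec (N + 1). \<forall>b \<in> carrier_vec (N + 1).
        a \<bullet> (H *\<^sub>v (D *\<^sub>v b)) = a $ N * b $ N - a $ 0 * b $ 0 - (D *\<^sub>v a) \<bullet> (H *\<^sub>v b))"

definition grid_fun :: "nat \<Rightarrow> (real \<Rightarrow> real) \<Rightarrow> real vec" where
  "grid_fun N \<phi> = vec (N + 1) (\<lambda>i. \<phi> (real i / real N))"

text \<open>The maximal truncation error tends to zero for every infinitely differentiable function.\<close>

definition consistent :: "(nat \<Rightarrow> real mat) \<Rightarrow> bool" where
  "consistent D \<longleftrightarrow>
     (\<forall>\<phi>. (\<forall>k x. (deriv ^^ k) \<phi> field_differentiable at x) \<longrightarrow>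
        (\<lambda>N. Max ((\<lambda>i. \<bar>(D N *\<^sub>v grid_fun N \<phi>) $ i - grid_fun N (deriv \<phi>) $ i\<bar>) ` {0..N}))
          \<longlonglongrightarrow> 0)"

section \<open>The semidiscrete system\<close>

definition kron :: "real mat \<Rightarrow> real mat \<Rightarrow> real mat"  (infixr \<open>\<otimes>\<^sub>K\<close> 75) where
  "X \<otimes>\<^sub>K Y = mat (dim_row X * dim_row Y) (dim_col X * dim_col Y)
     (\<lambda>(i, j). X $$ (i div dim_row Y, j div dim_col Y) * Y $$ (i mod dim_row Y, j mod dim_col Y))"

definition id_row :: "nat \<Rightarrow> nat \<Rightarrow> real mat" where
  "id_row n k = mat_of_row (row (1\<^sub>m n) k)"

definition antidiag :: "nat \<Rightarrow> real mat" where
  "antidiag n = mat n n (\<lambda>(i, j). if i + j + 1 = n then 1 else 0)"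

definition pad_rows :: "nat \<Rightarrow> real mat \<Rightarrow> real mat" where
  "pad_rows d M = M @\<^sub>r 0\<^sub>m (d - dim_row M) (dim_col M)"

text \<open>The component \<open>k\<close> of \<open>v\<^sub>i\<^sub>j\<close> is the entry \<open>(j (N\<^sub>1 + 1) + i) d + k\<close> of the grid vector.
  Below, \<open>H1\<close>, \<open>D1\<close>, \<open>H2\<close>, \<open>D2\<close> are the matrices for the given \<open>N1\<close>, \<open>N2\<close>.\<close>

definition gram_V :: "nat \<Rightarrow> real mat \<Rightarrow> real mat \<Rightarrow> real mat" where
  "gram_V d H1 H2 = H2 \<otimes>\<^sub>K H1 \<otimes>\<^sub>K 1\<^sub>m d"

definition gram_boundary :: "nat \<Rightarrow> nat \<Rightarrow> nat \<Rightarrow> real mat \<Rightarrow> real mat \<Rightarrow> real mat" where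
  "gram_boundary d N1 N2 H1 H2 =
     (let J1 = antidiag (N1 + 1); J2 = antidiag (N2 + 1) in
      diag_block_mat
        [H1 \<otimes>\<^sub>K 1\<^sub>m d, H2 \<otimes>\<^sub>K 1\<^sub>m d, (J1 * H1 * J1) \<otimes>\<^sub>K 1\<^sub>m d, (J2 * H2 * J2) \<otimes>\<^sub>K 1\<^sub>m d])"

definition boundary_op :: "nat \<Rightarrow> nat \<Rightarrow> nat \<Rightarrow> (side \<Rightarrow> real mat) \<Rightarrow> real mat" where
  "boundary_op d N1 N2 bc =
     (let I1 = 1\<^sub>m (N1 + 1); I2 = 1\<^sub>m (N2 + 1); M = (\<lambda>s. pad_rows d (bc s)) in
      (id_row (N2 + 1) 0 \<otimes>\<^sub>K I1 \<otimes>\<^sub>K M South) @\<^sub>r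
      (I2 \<otimes>\<^sub>K id_row (N1 + 1) N1 \<otimes>\<^sub>K M East) @\<^sub>r
      (id_row (N2 + 1) N2 \<otimes>\<^sub>K I1 \<otimes>\<^sub>K M North) @\<^sub>r
      (I2 \<otimes>\<^sub>K id_row (N1 + 1) 0 \<otimes>\<^sub>K M West))"

definition space_op ::
  "nat \<Rightarrow> nat \<Rightarrow> nat \<Rightarrow> real mat \<Rightarrow> real mat \<Rightarrow> real mat \<Rightarrow> real mat \<Rightarrow> real mat"
where
  "space_op d N1 N2 A B D1 D2 =
     (let I1 = 1\<^sub>m (N1 + 1); I2 = 1\<^sub>m (N2 + 1) in
      (I2 \<otimes>\<^sub>K I1 \<otimes>\<^sub>K A) * (I2 \<otimes>\<^sub>K D1 \<otimes>\<^sub>K 1\<^sub>m d) +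
      (I2 \<otimes>\<^sub>K I1 \<otimes>\<^sub>K B) * (D2 \<otimes>\<^sub>K I1 \<otimes>\<^sub>K 1\<^sub>m d))"

definition projection :: "real mat \<Rightarrow> real mat \<Rightarrow> real mat" where
  "projection L Lplus = 1\<^sub>m (dim_col L) - Lplus * L"

text \<open>\<open>v' + R v = 0\<close> for \<open>t > 0\<close>, \<open>v(0) = f\<close>, where \<open>v\<close> takes values in \<open>\<real>\<^sup>n\<close>.\<close>

definition solves :: "nat \<Rightarrow> real mat \<Rightarrow> real vec \<Rightarrow> (real \<Rightarrow> real vec) \<Rightarrow> bool" where
  "solves n R f v \<longleftrightarrow>
     (\<forall>t \<ge> 0. v t \<in> carrier_vec n) \<and> v 0 = f \<and>
     (\<forall>k < n. continuous_on {0..} (\<lambda>t. v t $ k) \<and>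
        (\<forall>t > 0. ((\<lambda>s. v s $ k) has_real_derivative - ((R *\<^sub>v v t) $ k)) (at t)))"

text \<open>Strict stability: all semidiscrete solutions on all grids obey one energy estimate
  \<open>\<parallel>v(t)\<parallel> \<le> exp (\<beta> t) \<parallel>f\<parallel>\<close> with \<open>\<beta>\<close> independent of the grid, and the growth rate \<open>\<beta>\<close> does not
  exceed any growth rate \<open>\<alpha>\<close> in the energy estimate (\<open>rate \<alpha>\<close>) of the continuous problem.
  On the grid \<open>(N1, N2)\<close> the state space has Gram matrix \<open>G N1 N2\<close> and the admissible initial
  data are those with \<open>P f = f\<close>.\<close>

definition strictly_stable ::
  "(real \<Rightarrow> bool) \<Rightarrow> (nat \<times> nat) set \<Rightarrow> (nat \<Rightarrow> nat \<Rightarrow> real mat) \<Rightarrow> (nat \<Rightarrow> nat \<Rightarrow> real mat) \<Rightarrow>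
   (nat \<Rightarrow> nat \<Rightarrow> real mat) \<Rightarrow> bool"
where
  "strictly_stable rate grids G P R \<longleftrightarrow>
     (\<exists>\<beta>. (\<forall>\<alpha>. rate \<alpha> \<longrightarrow> \<beta> \<le> \<alpha>) \<and>
       (\<forall>(N1, N2) \<in> grids. \<forall>f \<in> carrier_vec (dim_row (G N1 N2)). \<forall>v.
          P N1 N2 *\<^sub>v f = f \<longrightarrow> solves (dim_row (G N1 N2)) (R N1 N2) f v \<longrightarrow>
          (\<forall>t \<ge> 0. weighted_norm (G N1 N2) (v t) \<le> exp (\<beta> * t) * weighted_norm (G N1 N2) f)))"

end

theory Submission
  imports Defs
begin

no_notation Finite_Cartesian_Product.vec.vec_nth (infixl \<open>$\<close> 90)

text \<open>The growth rate \<open>0\<close> serves on every grid, and no energy estimate of the continuous problem has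
  a smaller one.

  Discrete side. Since \<open>L\<^sup>+ L\<close> is self-adjoint, so is \<open>P\<close>, and for \<open>w = P v\<close> the energy satisfies
  \<open>d/dt (v, v) = - 2 (w, (A D\<^sub>x + B D\<^sub>y) w)\<close>. Summation by parts turns \<open>2 (w, (A D\<^sub>x + B D\<^sub>y) w)\<close> into
  four quadratic forms, one for each side: on the side \<open>s\<close> with boundary values \<open>w\<^sub>i\<close> it is
  \<open>\<Sum>\<^sub>i\<^sub>j H\<^sub>i\<^sub>j (w\<^sub>i \<bullet> X w\<^sub>j)\<close>, where \<open>X\<close> is the symbol \<open>normal_mat A B s\<close> and \<open>H\<close> is the norm matrix along
  the side. Because \<open>L P = 0\<close>, every \<open>w\<^sub>i\<close> satisfies the boundary condition exactly, corner points
  included. It remains to know that \<open>X\<close> is nonnegative on the kernel of the boundary condition. If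
  \<open>H\<close> were diagonal, the form would then be a sum of nonnegative terms; for a full matrix \<open>H\<close> it is
  the entrywise pairing of the positive definite \<open>H\<close> with the positive semidefinite Gram-type matrix
  \<open>w\<^sub>i \<bullet> X w\<^sub>j\<close>, which is nonnegative as well (\<open>pd_psd_pairing_nonneg\<close>).

  Continuous side. The energy estimate is tested with the fields \<open>p(x) q(y) w\<close>. If \<open>p\<close> and \<open>q\<close> vanish
  at the end points, the boundary terms disappear and the estimate reads \<open>0 \<le> \<alpha> (u, u)\<close>, so
  \<open>\<alpha> \<ge> 0\<close> (\<open>energy_rate_nonneg\<close>). If the field concentrates at one side, its \<open>L\<^sup>2\<close> norm tends to zero
  while the boundary term of this side stays fixed, which forces \<open>w \<bullet> X w \<ge> 0\<close> for every \<open>w\<close> in the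
  kernel of the boundary condition (\<open>energy_rate_normal_nonneg\<close>).\<close>

section \<open>Kronecker products\<close>

lemma sum_lessThan_mult:
  fixes f :: "nat \<Rightarrow> 'a::comm_monoid_add"
  shows "(\<Sum>k<m * n. f k) = (\<Sum>i<m. \<Sum>j<n. f (i * n + j))"
proof -
  have "sum f {i * n..<i * n + n} = (\<Sum>j<n. f (i * n + j))" for i
    using sum.shift_bounds_nat_ivl[of f 0 "i * n" n]
    by (simp add: atLeast0LessThan add.commute)
  then show ?thesis by (simp add: sum.nat_group[of f n m, symmetric])
qed

lemma scalar_prod_mult_mat_vec_sum:
  assumes "M \<in> carrier_mat n m" "u \<in> carrier_vec n" "v \<in> carrier_vec m"
  shows "u \<bullet> (M *\<^sub>v v) = (\<Sum>i<n. \<Sum>j<m. u $ i * M $$ (i, j) * v $ j)"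
  using assms
  by (auto simp: scalar_prod_def atLeast0LessThan sum_distrib_left mult.assoc
      intro!: sum.cong)

lemma dim_kron [simp]:
  "dim_row (X \<otimes>\<^sub>K Y) = dim_row X * dim_row Y" "dim_col (X \<otimes>\<^sub>K Y) = dim_col X * dim_col Y"
  by (simp_all add: kron_def)

lemma kron_carrier [intro]:
  "X \<in> carrier_mat a b \<Longrightarrow> Y \<in> carrier_mat c d \<Longrightarrow> X \<otimes>\<^sub>K Y \<in> carrier_mat (a * c) (b * d)"
  by (auto intro!: carrier_matI)

lemma div_mod_less_mult:
  fixes i a b :: nat
  assumes "i < a * b"
  shows "i div b < a" "i mod b < b"
  using assms by (auto simp: less_mult_imp_div_less) (metis mod_less_divisor mult_0_right not_less_zero gr0I)

lemma index_kron:
  assumes "i < dim_row X * dim_row Y" "j < dim_col X * dim_col Y"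
  shows "(X \<otimes>\<^sub>K Y) $$ (i, j) =
    X $$ (i div dim_row Y, j div dim_col Y) * Y $$ (i mod dim_row Y, j mod dim_col Y)"
  using assms by (simp add: kron_def)

lemma kron_mult:
  assumes "dim_col X = dim_row Z" "dim_col Y = dim_row W"
  shows "(X \<otimes>\<^sub>K Y) * (Z \<otimes>\<^sub>K W) = (X * Z) \<otimes>\<^sub>K (Y * W)"
proof (rule eq_matI)
  fix i j
  assume "i < dim_row ((X * Z) \<otimes>\<^sub>K (Y * W))" "j < dim_col ((X * Z) \<otimes>\<^sub>K (Y * W))"
  then have i: "i < dim_row X * dim_row Y" and j: "j < dim_col Z * dim_col W" by auto
  note bounds = div_mod_less_mult[OF i] div_mod_less_mult[OF j]
  let ?i1 = "i div dim_row Y" and ?i2 = "i mod dim_row Y"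
  let ?j1 = "j div dim_col W" and ?j2 = "j mod dim_col W"
  have "((X \<otimes>\<^sub>K Y) * (Z \<otimes>\<^sub>K W)) $$ (i, j) =
      (\<Sum>k<dim_row Z * dim_row W. (X \<otimes>\<^sub>K Y) $$ (i, k) * (Z \<otimes>\<^sub>K W) $$ (k, j))"
    using i j assms by (simp add: scalar_prod_def atLeast0LessThan)
  also have "\<dots> = (\<Sum>k<dim_row Z * dim_row W.
      (X $$ (?i1, k div dim_row W) * Y $$ (?i2, k mod dim_row W)) *
      (Z $$ (k div dim_row W, ?j1) * W $$ (k mod dim_row W, ?j2)))"
    using i j assms by (intro sum.cong) (simp_all add: index_kron)
  also have "\<dots> = (\<Sum>k<dim_row Z. \<Sum>l<dim_row W.
      (X $$ (?i1, k) * Y $$ (?i2, l)) * (Z $$ (k, ?j1) * W $$ (l, ?j2)))"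
    unfolding sum_lessThan_mult by (intro sum.cong refl) simp
  also have "\<dots> = (\<Sum>k<dim_row Z. X $$ (?i1, k) * Z $$ (k, ?j1)) *
      (\<Sum>l<dim_row W. Y $$ (?i2, l) * W $$ (l, ?j2))"
    unfolding sum_product by (intro sum.cong refl) (simp add: mult_ac)
  also have "\<dots> = ((X * Z) \<otimes>\<^sub>K (Y * W)) $$ (i, j)"
    using i j assms bounds by (simp add: index_kron scalar_prod_def atLeast0LessThan)
  finally show "((X \<otimes>\<^sub>K Y) * (Z \<otimes>\<^sub>K W)) $$ (i, j) = ((X * Z) \<otimes>\<^sub>K (Y * W)) $$ (i, j)" .
qed auto

lemma transpose_kron: "(X \<otimes>\<^sub>K Y)\<^sup>T = X\<^sup>T \<otimes>\<^sub>K Y\<^sup>T"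
  by (rule eq_matI) (auto simp: index_kron div_mod_less_mult)

lemma kron_add_distrib:
  assumes "dim_row Y = dim_row Z" "dim_col Y = dim_col Z"
  shows "X \<otimes>\<^sub>K (Y + Z) = X \<otimes>\<^sub>K Y + X \<otimes>\<^sub>K Z" "(Y + Z) \<otimes>\<^sub>K X = Y \<otimes>\<^sub>K X + Z \<otimes>\<^sub>K X"
  using assms
  by (auto intro!: eq_matI simp: index_kron div_mod_less_mult algebra_simps)

lemma kron_diff_distrib:
  assumes "dim_row Y = dim_row Z" "dim_col Y = dim_col Z"
  shows "X \<otimes>\<^sub>K (Y - Z) = X \<otimes>\<^sub>K Y - X \<otimes>\<^sub>K Z" "(Y - Z) \<otimes>\<^sub>K X = Y \<otimes>\<^sub>K X - Z \<otimes>\<^sub>K X"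
  using assms
  by (auto intro!: eq_matI simp: index_kron div_mod_less_mult algebra_simps)

lemma one_kron [simp]: "1\<^sub>m (Suc 0) \<otimes>\<^sub>K X = X"
  by (rule eq_matI) (auto simp: index_kron)

lemma symmetric_mat_kron:
  assumes "symmetric_mat m X" "symmetric_mat n Y"
  shows "symmetric_mat (m * n) (X \<otimes>\<^sub>K Y)"
  using assms by (auto simp: symmetric_mat_def transpose_kron)

lemma symmetric_one: "symmetric_mat n (1\<^sub>m n)"
  by (simp add: symmetric_mat_def)

section \<open>Quadratic forms weighted by a positive definite matrix\<close>

text \<open>Schur complements reduce the claim to rank-one matrices. With \<open>h\<close> the row of \<open>H\<close> at the new
  index \<open>a\<close>, the matrix \<open>H - h h\<^sup>T / H\<^sub>a\<^sub>a\<close> vanishes in the row and column \<open>a\<close> and is again positive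
  definite on the remaining indices, while the pairing of \<open>h h\<^sup>T\<close> with \<open>K\<close> is a value of the
  quadratic form of \<open>K\<close>.\<close>

lemma pd_psd_pairing_nonneg:
  fixes H K :: "'a \<Rightarrow> 'a \<Rightarrow> real"
  assumes "finite F"
    and "\<And>i j. H i j = H j i"
    and "\<And>c. \<exists>i\<in>F. c i \<noteq> 0 \<Longrightarrow> (\<Sum>i\<in>F. \<Sum>j\<in>F. c i * c j * H i j) > 0"
    and "\<And>c. (\<Sum>i\<in>F. \<Sum>j\<in>F. c i * c j * K i j) \<ge> 0"
  shows "(\<Sum>i\<in>F. \<Sum>j\<in>F. H i j * K i j) \<ge> 0"
  using assms
proof (induction F arbitrary: H rule: finite_induct)
  case (insert a F H)
  note sym = insert.prems(1) and pd = insert.prems(2) and psd = insert.prems(3)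
  have ins: "(\<Sum>i\<in>insert a F. \<Sum>j\<in>insert a F. g i j) =
      g a a + (\<Sum>j\<in>F. g a j) + (\<Sum>i\<in>F. g i a) + (\<Sum>i\<in>F. \<Sum>j\<in>F. g i j)"
    for g :: "'a \<Rightarrow> 'a \<Rightarrow> real"
    using insert.hyps by (simp add: sum.distrib)
  have out: "i \<in> F \<Longrightarrow> i \<noteq> a" for i using insert.hyps by auto
  define h where "h = H a a"
  have "(\<Sum>i\<in>insert a F. \<Sum>j\<in>insert a F. (if i = a then 1 else 0) * (if j = a then 1 else 0) * H i j) > 0"
    by (rule pd) auto
  then have h: "h > 0"
    unfolding ins h_def using out by simp
  define H' where "H' i j = H i j - H a i * H a j / h" for i j
  have "(\<Sum>i\<in>F. \<Sum>j\<in>F. H' i j * K i j) \<ge> 0"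
  proof (rule insert.IH)
    show "H' i j = H' j i" for i j by (simp add: H'_def sym[of i j])
    show "(\<Sum>i\<in>F. \<Sum>j\<in>F. c i * c j * K i j) \<ge> 0" for c
    proof -
      have "(\<Sum>i\<in>F. \<Sum>j\<in>F. (c(a := 0)) i * (c(a := 0)) j * K i j) = (\<Sum>i\<in>F. \<Sum>j\<in>F. c i * c j * K i j)"
        using out by (intro sum.cong refl) auto
      then show ?thesis using psd[of "c(a := 0)"] unfolding ins by simp
    qed
    show "(\<Sum>i\<in>F. \<Sum>j\<in>F. c i * c j * H' i j) > 0" if c: "\<exists>i\<in>F. c i \<noteq> 0" for c
    proof -
      define s where "s = (\<Sum>j\<in>F. c j * H a j)"
      define T where "T = (\<Sum>i\<in>F. \<Sum>j\<in>F. c i * c j * H i j)"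
      \<comment> \<open>The coefficient at \<open>a\<close> that minimizes the form of \<open>H\<close> when the others are those of \<open>c\<close>.\<close>
      define c' where "c' = c(a := - s / h)"
      have c'F: "c' i = c i" if "i \<in> F" for i using out[OF that] by (simp add: c'_def)
      have "0 < (\<Sum>i\<in>insert a F. \<Sum>j\<in>insert a F. c' i * c' j * H i j)"
        using c c'F by (intro pd) auto
      also have "\<dots> = c' a * c' a * h + c' a * s + c' a * s + T"
      proof -
        have "(\<Sum>j\<in>F. c' a * c' j * H a j) = c' a * s"
          unfolding s_def sum_distrib_left by (intro sum.cong refl) (simp add: c'F)
        moreover have "(\<Sum>i\<in>F. c' i * c' a * H i a) = c' a * s"
          unfolding s_def sum_distrib_left by (intro sum.cong refl) (simp add: c'F sym[of _ a])
        moreover have "(\<Sum>i\<in>F. \<Sum>j\<in>F. c' i * c' j * H i j) = T"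
          unfolding T_def by (intro sum.cong refl) (simp add: c'F)
        ultimately show ?thesis unfolding ins by (simp add: h_def)
      qed
      also have "\<dots> = T - s * s / h"
        using h by (simp add: c'_def field_simps)
      also have "\<dots> = (\<Sum>i\<in>F. \<Sum>j\<in>F. c i * c j * H' i j)"
        unfolding T_def s_def H'_def sum_product sum_divide_distrib sum_subtractf[symmetric]
        by (intro sum.cong refl) (simp add: algebra_simps)
      finally show ?thesis .
    qed
  qed
  moreover have "(\<Sum>i\<in>insert a F. \<Sum>j\<in>insert a F. H' i j * K i j) = (\<Sum>i\<in>F. \<Sum>j\<in>F. H' i j * K i j)"
  proof -
    have "H' a j = 0" "H' j a = 0" for j
      using h sym[of j a] by (simp_all add: H'_def h_def)
    then show ?thesis unfolding ins by simp
  qed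
  moreover have "(\<Sum>i\<in>insert a F. \<Sum>j\<in>insert a F. H i j * K i j) =
      (\<Sum>i\<in>insert a F. \<Sum>j\<in>insert a F. H a i * H a j * K i j) / h +
      (\<Sum>i\<in>insert a F. \<Sum>j\<in>insert a F. H' i j * K i j)"
    unfolding H'_def sum_divide_distrib sum.distrib[symmetric]
    by (intro sum.cong refl) (simp add: algebra_simps)
  moreover have "(\<Sum>i\<in>insert a F. \<Sum>j\<in>insert a F. H a i * H a j * K i j) / h \<ge> 0"
    using psd[of "H a"] h by simp
  ultimately show ?case by linarith
qed simp

lemma index_one_kron_mult_vec:
  assumes M: "M \<in> carrier_mat r d" and z: "z \<in> carrier_vec (n * d)" and "i < n" "k < r"
  shows "((1\<^sub>m n \<otimes>\<^sub>K M) *\<^sub>v z) $ (i * r + k) = (M *\<^sub>v vec d (\<lambda>l. z $ (i * d + l))) $ k"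
proof -
  have "i * r + k < Suc i * r" using \<open>k < r\<close> by simp
  also have "\<dots> \<le> n * r" using \<open>i < n\<close> by (intro mult_le_mono1) simp
  finally have ik: "i * r + k < n * r" .
  have "((1\<^sub>m n \<otimes>\<^sub>K M) *\<^sub>v z) $ (i * r + k) = (\<Sum>j<n * d. (1\<^sub>m n \<otimes>\<^sub>K M) $$ (i * r + k, j) * z $ j)"
    using ik M z by (simp add: scalar_prod_def atLeast0LessThan)
  also have "\<dots> = (\<Sum>j<n * d. (1\<^sub>m n $$ (i, j div d) * M $$ (k, j mod d)) * z $ j)"
    using ik M \<open>k < r\<close> by (intro sum.cong) (simp_all add: index_kron)
  also have "\<dots> = (\<Sum>j<n. \<Sum>l<d. (1\<^sub>m n $$ (i, j) * M $$ (k, l)) * z $ (j * d + l))"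
    unfolding sum_lessThan_mult by (intro sum.cong refl) simp
  also have "\<dots> = (\<Sum>j<n. if j = i then \<Sum>l<d. M $$ (k, l) * z $ (j * d + l) else 0)"
    using \<open>i < n\<close> by (intro sum.cong refl) auto
  also have "\<dots> = (\<Sum>l<d. M $$ (k, l) * z $ (i * d + l))"
    using \<open>i < n\<close> by simp
  also have "\<dots> = (M *\<^sub>v vec d (\<lambda>l. z $ (i * d + l))) $ k"
    using M \<open>k < r\<close> by (simp add: scalar_prod_def atLeast0LessThan)
  finally show ?thesis .
qed

text \<open>The blocks \<open>b\<^sub>i\<close> of \<open>z\<close> lie in the kernel of \<open>M\<close>, hence so do their linear combinations; thus
  \<open>b\<^sub>i \<bullet> A b\<^sub>j\<close> is positive semidefinite, and its pairing with \<open>H\<close> is the form in question.\<close>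

lemma kron_form_nonneg:
  assumes H: "spd n H" and A: "A \<in> carrier_mat d d" and M: "M \<in> carrier_mat r d"
    and nonneg: "\<And>x. x \<in> carrier_vec d \<Longrightarrow> M *\<^sub>v x = 0\<^sub>v r \<Longrightarrow> x \<bullet> (A *\<^sub>v x) \<ge> 0"
    and z: "z \<in> carrier_vec (n * d)" and Mz: "(1\<^sub>m n \<otimes>\<^sub>K M) *\<^sub>v z = 0\<^sub>v (n * r)"
  shows "z \<bullet> ((H \<otimes>\<^sub>K A) *\<^sub>v z) \<ge> 0"
proof -
  have Hc: "H \<in> carrier_mat n n" and Hs: "H\<^sup>T = H" using H by (auto simp: spd_def symmetric_mat_def)
  define b where "b i = vec d (\<lambda>l. z $ (i * d + l))" for i
  have b: "b i \<in> carrier_vec d" for i by (simp add: b_def)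
  have Mb: "M *\<^sub>v b i = 0\<^sub>v r" if "i < n" for i
  proof (rule eq_vecI)
    show "dim_vec (M *\<^sub>v b i) = dim_vec (0\<^sub>v r :: real vec)" using M by simp
    fix k assume k: "k < dim_vec (0\<^sub>v r :: real vec)"
    have "i * r + k < Suc i * r" using k by simp
    also have "\<dots> \<le> n * r" using that by (intro mult_le_mono1) simp
    finally show "(M *\<^sub>v b i) $ k = 0\<^sub>v r $ k"
      using index_one_kron_mult_vec[OF M z that, of k] k Mz by (simp add: b_def)
  qed
  define K where "K i j = b i \<bullet> (A *\<^sub>v b j)" for i j
  have Ksum: "K i j = (\<Sum>k<d. \<Sum>l<d. z $ (i * d + k) * A $$ (k, l) * z $ (j * d + l))" for i j
    unfolding K_def scalar_prod_mult_mat_vec_sum[OF A b b] by (intro sum.cong refl) (simp add: b_def)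
  have psd: "(\<Sum>i<n. \<Sum>j<n. c i * c j * K i j) \<ge> 0" for c
  proof -
    define x where "x = vec d (\<lambda>l. \<Sum>i<n. c i * z $ (i * d + l))"
    have x: "x \<in> carrier_vec d" by (simp add: x_def)
    have "M *\<^sub>v x = 0\<^sub>v r"
    proof (rule eq_vecI)
      show "dim_vec (M *\<^sub>v x) = dim_vec (0\<^sub>v r :: real vec)" using M by simp
      fix k assume k: "k < dim_vec (0\<^sub>v r :: real vec)"
      have "(M *\<^sub>v x) $ k = (\<Sum>l<d. \<Sum>i<n. c i * (M $$ (k, l) * z $ (i * d + l)))"
        using M k by (simp add: scalar_prod_def atLeast0LessThan x_def sum_distrib_left mult_ac)
      also have "\<dots> = (\<Sum>i<n. \<Sum>l<d. c i * (M $$ (k, l) * z $ (i * d + l)))" by (rule sum.swap)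
      also have "\<dots> = (\<Sum>i<n. c i * (M *\<^sub>v b i) $ k)"
        using M k by (simp add: scalar_prod_def atLeast0LessThan b_def sum_distrib_left)
      also have "\<dots> = 0" using k by (simp add: Mb)
      finally show "(M *\<^sub>v x) $ k = 0\<^sub>v r $ k" using k by simp
    qed
    with nonneg x have "0 \<le> x \<bullet> (A *\<^sub>v x)" by blast
    also have "\<dots> = (\<Sum>k<d. \<Sum>l<d. (\<Sum>i<n. c i * z $ (i * d + k)) * A $$ (k, l) * (\<Sum>j<n. c j * z $ (j * d + l)))"
      unfolding scalar_prod_mult_mat_vec_sum[OF A x x] by (intro sum.cong refl) (simp add: x_def)
    also have "\<dots> = (\<Sum>k<d. \<Sum>l<d. \<Sum>i<n. \<Sum>j<n. c i * c j * (z $ (i * d + k) * A $$ (k, l) * z $ (j * d + l)))"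
      by (intro sum.cong refl) (simp add: sum_distrib_left sum_distrib_right mult_ac)
    also have "\<dots> = (\<Sum>k<d. \<Sum>i<n. \<Sum>l<d. \<Sum>j<n. c i * c j * (z $ (i * d + k) * A $$ (k, l) * z $ (j * d + l)))"
      by (intro sum.cong refl sum.swap)
    also have "\<dots> = (\<Sum>i<n. \<Sum>k<d. \<Sum>j<n. \<Sum>l<d. c i * c j * (z $ (i * d + k) * A $$ (k, l) * z $ (j * d + l)))"
      by (subst sum.swap) (intro sum.cong refl sum.swap)
    also have "\<dots> = (\<Sum>i<n. \<Sum>j<n. \<Sum>k<d. \<Sum>l<d. c i * c j * (z $ (i * d + k) * A $$ (k, l) * z $ (j * d + l)))"
      by (intro sum.cong refl sum.swap)
    also have "\<dots> = (\<Sum>i<n. \<Sum>j<n. c i * c j * K i j)"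
      by (simp add: Ksum sum_distrib_left)
    finally show ?thesis .
  qed
  have HA: "H \<otimes>\<^sub>K A \<in> carrier_mat (n * d) (n * d)" using Hc A by auto
  have "0 \<le> (\<Sum>i<n. \<Sum>j<n. (if i < n \<and> j < n then H $$ (i, j) else 0) * K i j)"
  proof (rule pd_psd_pairing_nonneg[OF _ _ _ psd])
    have "H $$ (i, j) = H $$ (j, i)" if "i < n" "j < n" for i j
      using Hs that Hc by (metis carrier_matD index_transpose_mat(1))
    then show "(if i < n \<and> j < n then H $$ (i, j) else 0) = (if j < n \<and> i < n then H $$ (j, i) else 0)" for i j
      by simp
    show "(\<Sum>i<n. \<Sum>j<n. c i * c j * (if i < n \<and> j < n then H $$ (i, j) else 0)) > 0" if "\<exists>i\<in>{..<n}. c i \<noteq> 0" for c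
    proof -
      have "vec n c \<noteq> 0\<^sub>v n" using that by (auto simp: vec_eq_iff)
      then have "vec n c \<bullet> (H *\<^sub>v vec n c) > 0" using H by (simp add: spd_def)
      also have "vec n c \<bullet> (H *\<^sub>v vec n c) = (\<Sum>i<n. \<Sum>j<n. c i * c j * (if i < n \<and> j < n then H $$ (i, j) else 0))"
        using Hc by (subst scalar_prod_mult_mat_vec_sum[of _ n n]) (auto intro!: sum.cong)
      finally show ?thesis .
    qed
  qed simp
  also have "\<dots> = (\<Sum>i<n. \<Sum>j<n. \<Sum>k<d. \<Sum>l<d. z $ (i * d + k) * (H $$ (i, j) * A $$ (k, l)) * z $ (j * d + l))"
    by (intro sum.cong refl) (simp add: Ksum sum_distrib_left mult_ac)
  also have "\<dots> = (\<Sum>i<n. \<Sum>k<d. \<Sum>j<n. \<Sum>l<d. z $ (i * d + k) * (H $$ (i, j) * A $$ (k, l)) * z $ (j * d + l))"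
    by (intro sum.cong refl sum.swap)
  also have "\<dots> = (\<Sum>p<n * d. \<Sum>q<n * d. z $ p * (H $$ (p div d, q div d) * A $$ (p mod d, q mod d)) * z $ q)"
    unfolding sum_lessThan_mult by (intro sum.cong refl) simp
  also have "\<dots> = z \<bullet> ((H \<otimes>\<^sub>K A) *\<^sub>v z)"
    unfolding scalar_prod_mult_mat_vec_sum[OF HA z z] using Hc A
    by (intro sum.cong refl) (simp add: index_kron)
  finally show ?thesis .
qed

section \<open>Consequences of the continuous energy estimate\<close>

lemma integral_unit_square_product:
  fixes f g :: "real \<Rightarrow> real"
  assumes f: "continuous_on {0..1} f" and g: "continuous_on {0..1} g"
  shows "integral unit_square (\<lambda>p. f (fst p) * g (snd p)) = integral {0..1} f * integral {0..1} g"
    and "(\<lambda>p. f (fst p) * g (snd p)) integrable_on unit_square"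
proof -
  have sq: "unit_square = cbox (0, 0) (1, 1)"
    by (simp add: unit_square_def cbox_Pair_eq)
  have c: "continuous_on (cbox (0, 0) (1, 1)) (\<lambda>p. f (fst p) * g (snd p))"
    by (intro continuous_intros continuous_on_compose2[OF f] continuous_on_compose2[OF g])
      (auto simp: cbox_Pair_eq)
  show "integral unit_square (\<lambda>p. f (fst p) * g (snd p)) = integral {0..1} f * integral {0..1} g"
    unfolding sq integral_prod_continuous[OF c] by simp
  show "(\<lambda>p. f (fst p) * g (snd p)) integrable_on unit_square"
    unfolding sq by (rule integrable_continuous[OF c])
qed

lemma integral_mult_deriv_self:
  fixes p p' :: "real \<Rightarrow> real"
  assumes p: "\<And>x. x \<in> {0..1} \<Longrightarrow> (p has_real_derivative p' x) (at x within {0..1})"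
  shows "integral {0..1} (\<lambda>x. p x * p' x) = ((p 1)\<^sup>2 - (p 0)\<^sup>2) / 2"
proof -
  have "((\<lambda>x. p x * p' x) has_integral (p 1)\<^sup>2 / 2 - (p 0)\<^sup>2 / 2) {0..1}"
  proof (rule fundamental_theorem_of_calculus)
    fix x :: real assume "x \<in> {0..1}"
    from p[OF this] show "((\<lambda>x. (p x)\<^sup>2 / 2) has_vector_derivative p x * p' x) (at x within {0..1})"
      unfolding has_real_derivative_iff_has_vector_derivative[symmetric]
      by (auto intro!: derivative_eq_intros)
  qed simp
  then show ?thesis by (simp add: integral_unique diff_divide_distrib)
qed

text \<open>For the separated field \<open>u = p(x) q(y) w\<close> all integrals factor, and
  \<open>p p' = (p\<^sup>2)' / 2\<close> leaves only the values of \<open>p\<^sup>2\<close> and \<open>q\<^sup>2\<close> at the end points. The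
  alternative in the last hypothesis makes \<open>u\<close> satisfy the boundary conditions on every side.\<close>

lemma energy_rate_product_field:
  fixes p p' q q' :: "real \<Rightarrow> real"
  assumes rate: "energy_rate d A B bc \<alpha>"
    and A: "A \<in> carrier_mat d d" and B: "B \<in> carrier_mat d d" and w: "w \<in> carrier_vec d"
    and p: "\<And>x. x \<in> {0..1} \<Longrightarrow> (p has_real_derivative p' x) (at x within {0..1})"
    and q: "\<And>x. x \<in> {0..1} \<Longrightarrow> (q has_real_derivative q' x) (at x within {0..1})"
    and p': "continuous_on {0..1} p'" and q': "continuous_on {0..1} q'"
    and bc: "\<And>s. dim_col (bc s) = d"
    and bdry: "\<And>s x y. (x, y) \<in> side_points s \<Longrightarrow> p x * q y = 0 \<or> bc s *\<^sub>v w = 0\<^sub>v (dim_row (bc s))"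
  shows "- (w \<bullet> (A *\<^sub>v w)) * ((p 1)\<^sup>2 - (p 0)\<^sup>2) / 2 * integral {0..1} (\<lambda>y. (q y)\<^sup>2)
         - (w \<bullet> (B *\<^sub>v w)) * ((q 1)\<^sup>2 - (q 0)\<^sup>2) / 2 * integral {0..1} (\<lambda>x. (p x)\<^sup>2)
         \<le> \<alpha> * ((w \<bullet> w) * (integral {0..1} (\<lambda>x. (p x)\<^sup>2) * integral {0..1} (\<lambda>y. (q y)\<^sup>2)))"
proof -
  define u where "u = (\<lambda>z. (p (fst z) * q (snd z)) \<cdot>\<^sub>v w)"
  define ux where "ux = (\<lambda>z. (p' (fst z) * q (snd z)) \<cdot>\<^sub>v w)"
  define uy where "uy = (\<lambda>z. (p (fst z) * q' (snd z)) \<cdot>\<^sub>v w)"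
  have pc: "continuous_on {0..1} p" and qc: "continuous_on {0..1} q"
    using DERIV_continuous[OF p] DERIV_continuous[OF q]
    by (auto simp: continuous_on_eq_continuous_within)
  have cont: "continuous_on unit_square (\<lambda>z. f (fst z) * g (snd z) * c)"
    if "continuous_on {0..1} f" "continuous_on {0..1} g" for f g :: "real \<Rightarrow> real" and c
    by (intro continuous_intros continuous_on_compose2[OF that(1)] continuous_on_compose2[OF that(2)])
      (auto simp: unit_square_def)
  have dw: "dim_vec w = d" using w by simp
  have C1: "C1_square d u ux uy"
    unfolding C1_square_def u_def ux_def uy_def
    using w p q cont[OF pc qc] cont[OF p' qc] cont[OF pc q']
    by (auto intro!: derivative_eq_intros simp: dw)
  have "L2_inner u (\<lambda>z. - (A *\<^sub>v ux z + B *\<^sub>v uy z)) \<le> \<alpha> * L2_inner u u"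
  proof (rule rate[unfolded energy_rate_def, rule_format, OF C1])
    fix s z assume z: "z \<in> side_points s"
    obtain x y where xy: "z = (x, y)" by (cases z)
    have "bc s *\<^sub>v u z = (p x * q y) \<cdot>\<^sub>v (bc s *\<^sub>v w)"
      unfolding u_def xy by (simp add: mult_mat_vec[OF carrier_matI[OF refl bc] w])
    then show "bc s *\<^sub>v u z = 0\<^sub>v (dim_row (bc s))"
      using bdry[of x y s] z xy by (auto intro!: eq_vecI)
  qed
  also have "L2_inner u u = (w \<bullet> w) * (integral {0..1} (\<lambda>x. (p x)\<^sup>2) * integral {0..1} (\<lambda>y. (q y)\<^sup>2))"
  proof -
    have "L2_inner u u = integral unit_square (\<lambda>z. (w \<bullet> w) * ((p (fst z))\<^sup>2 * (q (snd z))\<^sup>2))"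
      unfolding L2_inner_def u_def using w
      by (intro Henstock_Kurzweil_Integration.integral_cong) (simp add: power2_eq_square)
    also have "\<dots> = (w \<bullet> w) * (integral {0..1} (\<lambda>x. (p x)\<^sup>2) * integral {0..1} (\<lambda>y. (q y)\<^sup>2))"
      by (subst integral_mult_right, subst integral_unit_square_product)
        (auto intro!: continuous_intros pc qc)
    finally show ?thesis .
  qed
  also have "L2_inner u (\<lambda>z. - (A *\<^sub>v ux z + B *\<^sub>v uy z)) =
      - (w \<bullet> (A *\<^sub>v w)) * ((p 1)\<^sup>2 - (p 0)\<^sup>2) / 2 * integral {0..1} (\<lambda>y. (q y)\<^sup>2)
      - (w \<bullet> (B *\<^sub>v w)) * ((q 1)\<^sup>2 - (q 0)\<^sup>2) / 2 * integral {0..1} (\<lambda>x. (p x)\<^sup>2)"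
  proof -
    have Aw: "A *\<^sub>v w \<in> carrier_vec d" and Bw: "B *\<^sub>v w \<in> carrier_vec d" using A B w by auto
    have pp: "integral {0..1} (\<lambda>x. p x * p' x) = ((p 1)\<^sup>2 - (p 0)\<^sup>2) / 2"
      by (rule integral_mult_deriv_self) (rule p)
    have qq: "integral {0..1} (\<lambda>x. q x * q' x) = ((q 1)\<^sup>2 - (q 0)\<^sup>2) / 2"
      by (rule integral_mult_deriv_self) (rule q)
    have iA: "(\<lambda>z. p (fst z) * p' (fst z) * (q (snd z))\<^sup>2) integrable_on unit_square"
      by (rule integral_unit_square_product(2)) (intro continuous_intros pc qc p')+
    have iB: "(\<lambda>z. (p (fst z))\<^sup>2 * (q (snd z) * q' (snd z))) integrable_on unit_square"
      by (rule integral_unit_square_product(2)) (intro continuous_intros pc qc q')+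
    have lin: "w \<bullet> (- (a \<cdot>\<^sub>v (A *\<^sub>v w) + b \<cdot>\<^sub>v (B *\<^sub>v w))) = - (a * (w \<bullet> (A *\<^sub>v w))) - b * (w \<bullet> (B *\<^sub>v w))" for a b
    proof -
      have "w \<bullet> (a \<cdot>\<^sub>v (A *\<^sub>v w) + b \<cdot>\<^sub>v (B *\<^sub>v w)) = a * (w \<bullet> (A *\<^sub>v w)) + b * (w \<bullet> (B *\<^sub>v w))"
        using w Aw Bw by (subst scalar_prod_add_distrib[of _ d]) auto
      then show ?thesis using w A B by (subst scalar_prod_uminus_right) auto
    qed
    have "u z \<bullet> (- (A *\<^sub>v ux z + B *\<^sub>v uy z)) =
        - (w \<bullet> (A *\<^sub>v w)) * (p (fst z) * p' (fst z) * (q (snd z))\<^sup>2) +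
        - (w \<bullet> (B *\<^sub>v w)) * ((p (fst z))\<^sup>2 * (q (snd z) * q' (snd z)))" for z
      unfolding u_def ux_def uy_def mult_mat_vec[OF A w] mult_mat_vec[OF B w]
      using w A B by (subst smult_scalar_prod_distrib[of _ d])
        (auto simp: lin power2_eq_square algebra_simps)
    then have "L2_inner u (\<lambda>z. - (A *\<^sub>v ux z + B *\<^sub>v uy z)) = integral unit_square (\<lambda>z.
        - (w \<bullet> (A *\<^sub>v w)) * (p (fst z) * p' (fst z) * (q (snd z))\<^sup>2) +
        - (w \<bullet> (B *\<^sub>v w)) * ((p (fst z))\<^sup>2 * (q (snd z) * q' (snd z))))"
      unfolding L2_inner_def by presburger
    also have "\<dots> =
        - (w \<bullet> (A *\<^sub>v w)) * integral unit_square (\<lambda>z. p (fst z) * p' (fst z) * (q (snd z))\<^sup>2) +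
        - (w \<bullet> (B *\<^sub>v w)) * integral unit_square (\<lambda>z. (p (fst z))\<^sup>2 * (q (snd z) * q' (snd z)))"
      unfolding Henstock_Kurzweil_Integration.integral_add
        [OF integrable_on_mult_right[OF iA] integrable_on_mult_right[OF iB]]
      by (simp only: integral_mult_right)
    also have "integral unit_square (\<lambda>z. p (fst z) * p' (fst z) * (q (snd z))\<^sup>2) =
        ((p 1)\<^sup>2 - (p 0)\<^sup>2) / 2 * integral {0..1} (\<lambda>y. (q y)\<^sup>2)"
      unfolding pp[symmetric]
      by (rule integral_unit_square_product(1)) (intro continuous_intros pc qc p')+
    also have "integral unit_square (\<lambda>z. (p (fst z))\<^sup>2 * (q (snd z) * q' (snd z))) =
        integral {0..1} (\<lambda>x. (p x)\<^sup>2) * (((q 1)\<^sup>2 - (q 0)\<^sup>2) / 2)"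
      unfolding qq[symmetric]
      by (rule integral_unit_square_product(1)) (intro continuous_intros pc qc q')+
    finally show ?thesis by (simp add: diff_divide_distrib algebra_simps)
  qed
  finally show ?thesis .
qed

text \<open>The factor of the test fields along a side, vanishing at the corners.\<close>

definition bump :: "real \<Rightarrow> real" where "bump x = x * (1 - x)"

lemma bump_deriv: "(bump has_real_derivative 1 - 2 * x) (at x within S)"
  unfolding bump_def by (auto intro!: derivative_eq_intros)

lemma continuous_on_bump_deriv: "continuous_on S (\<lambda>x::real. 1 - 2 * x)"
  by (intro continuous_intros)

lemma bump_ends [simp]: "bump 0 = 0" "bump 1 = 0"
  by (simp_all add: bump_def)

lemma integral_bump_square_pos: "integral {0..1} (\<lambda>x. (bump x)\<^sup>2) > 0"
proof -
  let ?F = "\<lambda>x::real. x ^ 3 / 3 - x ^ 4 / 2 + x ^ 5 / 5"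
  have "((\<lambda>x. (bump x)\<^sup>2) has_integral ?F 1 - ?F 0) {0..1}"
  proof (rule fundamental_theorem_of_calculus)
    fix x :: real
    have "(bump x)\<^sup>2 = x\<^sup>2 - 2 * x ^ 3 + x ^ 4"
      by (simp add: bump_def algebra_simps power2_eq_square power3_eq_cube power4_eq_xxxx)
    moreover have "(?F has_real_derivative x\<^sup>2 - 2 * x ^ 3 + x ^ 4) (at x within {0..1})"
      by (rule derivative_eq_intros refl | simp)+
    ultimately show "(?F has_vector_derivative (bump x)\<^sup>2) (at x within {0..1})"
      by (simp add: has_real_derivative_iff_has_vector_derivative)
  qed simp
  then have "integral {0..1} (\<lambda>x. (bump x)\<^sup>2) = 1/3 - 1/2 + 1/5"
    by (simp add: integral_unique)
  then show ?thesis by simp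
qed

text \<open>A field that vanishes on the whole boundary satisfies any boundary conditions and neither gains
  nor loses energy, so a negative rate would contradict \<open>(u, u) > 0\<close>.\<close>

lemma energy_rate_nonneg:
  assumes rate: "energy_rate d A B bc \<alpha>" and "0 < d"
    and A: "A \<in> carrier_mat d d" and B: "B \<in> carrier_mat d d"
    and bc: "\<And>s. dim_col (bc s) = d"
  shows "0 \<le> \<alpha>"
proof -
  let ?w = "unit_vec d 0 :: real vec" and ?I = "integral {0..1} (\<lambda>x. (bump x)\<^sup>2)"
  have "bump x * bump y = 0" if "(x, y) \<in> side_points s" for x y s
    using that by (cases s) auto
  from energy_rate_product_field[OF rate A B _ bump_deriv bump_deriv continuous_on_bump_deriv continuous_on_bump_deriv bc, of ?w] this
  have "0 \<le> \<alpha> * ((?w \<bullet> ?w) * (?I * ?I))"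
    by simp
  moreover have "?w \<bullet> ?w = 1" using \<open>0 < d\<close> by simp
  moreover have "0 < ?I * ?I" using integral_bump_square_pos by simp
  ultimately show ?thesis by (metis mult_1 mult_less_0_iff not_le)
qed

text \<open>In the direction normal to the side \<open>s\<close> the test field is \<open>t\<^sup>n\<^sup>+\<^sup>1\<close>, where \<open>t\<close> runs from \<open>0\<close> at the
  opposite side to \<open>1\<close> at \<open>s\<close>; along the side it is a bump, so that the field vanishes on the other
  three sides and \<open>w\<close> has to satisfy the condition of \<open>s\<close> alone. The boundary term does not depend on \<open>n\<close>, whereas the
  squared norm decays like \<open>1 / (2 n + 3)\<close>.\<close>

lemma energy_rate_normal_nonneg:
  assumes rate: "energy_rate d A B bc \<alpha>"
    and A: "A \<in> carrier_mat d d" and B: "B \<in> carrier_mat d d"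
    and bc: "\<And>s. dim_col (bc s) = d"
    and w: "w \<in> carrier_vec d" and ker: "bc s *\<^sub>v w = 0\<^sub>v (dim_row (bc s))"
  shows "0 \<le> w \<bullet> (normal_mat A B s *\<^sub>v w)"
proof -
  let ?I = "integral {0..1} (\<lambda>x. (bump x)\<^sup>2)"
  let ?X = "w \<bullet> (normal_mat A B s *\<^sub>v w)"
  define p0 p1 where "p0 n x = (1 - x) ^ Suc n" and "p1 n x = x ^ Suc n" for n and x :: real
  have d0: "(p0 n has_real_derivative - (real (Suc n) * (1 - x) ^ n)) (at x within T)"
    and d1: "(p1 n has_real_derivative real (Suc n) * x ^ n) (at x within T)" for n x T
    unfolding p0_def p1_def by (auto intro!: derivative_eq_intros simp del: power_Suc)
  have c0: "continuous_on T (\<lambda>x. - (real (Suc n) * (1 - x) ^ n))"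
    and c1: "continuous_on T (\<lambda>x. real (Suc n) * x ^ n)" for n T
    by (intro continuous_intros)+
  have ends [simp]: "p0 n 0 = 1" "p0 n 1 = 0" "p1 n 0 = 0" "p1 n 1 = 1" for n
    by (simp_all add: p0_def p1_def)
  have I1: "integral {0..1} (\<lambda>x. (p1 n x)\<^sup>2) = 1 / (2 * real n + 3)" for n
  proof -
    have "((\<lambda>x. (p1 n x)\<^sup>2) has_integral
        (\<lambda>x. x ^ (2 * n + 3) / (2 * real n + 3)) 1 - (\<lambda>x. x ^ (2 * n + 3) / (2 * real n + 3)) 0) {0..1}"
    proof (rule fundamental_theorem_of_calculus)
      fix x :: real
      have "(p1 n x)\<^sup>2 = x ^ (2 * n + 2)" by (simp add: p1_def power_mult[symmetric] power_add power2_eq_square mult_2)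
      moreover have "((\<lambda>x. x ^ (2 * n + 3) / (2 * real n + 3)) has_real_derivative x ^ (2 * n + 2)) (at x within {0..1})"
        by (rule derivative_eq_intros refl | simp)+ 
      ultimately show "((\<lambda>x. x ^ (2 * n + 3) / (2 * real n + 3)) has_vector_derivative (p1 n x)\<^sup>2) (at x within {0..1})"
        by (simp add: has_real_derivative_iff_has_vector_derivative)
    qed simp
    then show ?thesis by (simp add: integral_unique)
  qed
  have I0: "integral {0..1} (\<lambda>x. (p0 n x)\<^sup>2) = 1 / (2 * real n + 3)" for n
  proof -
    have "((\<lambda>x. (p0 n x)\<^sup>2) has_integral
        (\<lambda>x. - ((1 - x) ^ (2 * n + 3) / (2 * real n + 3))) 1 - (\<lambda>x. - ((1 - x) ^ (2 * n + 3) / (2 * real n + 3))) 0) {0..1}"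
    proof (rule fundamental_theorem_of_calculus)
      fix x :: real
      have "(p0 n x)\<^sup>2 = (1 - x) ^ (2 * n + 2)" by (simp add: p0_def power_mult[symmetric] power_add power2_eq_square mult_2)
      moreover have "((\<lambda>x. - ((1 - x) ^ (2 * n + 3) / (2 * real n + 3))) has_real_derivative (1 - x) ^ (2 * n + 2)) (at x within {0..1})"
        by (rule derivative_eq_intros refl | simp)+
      ultimately show "((\<lambda>x. - ((1 - x) ^ (2 * n + 3) / (2 * real n + 3))) has_vector_derivative (p0 n x)\<^sup>2) (at x within {0..1})"
        by (simp add: has_real_derivative_iff_has_vector_derivative)
    qed simp
    then show ?thesis by (simp add: integral_unique)
  qed
  note test = energy_rate_product_field[OF rate A B w _ _ _ _ bc]
  have "- ?X / 2 * ?I \<le> \<alpha> * ((w \<bullet> w) * (1 / (2 * real n + 3) * ?I))" for n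
  proof (cases s)
    case South
    have "bump x * p0 n y = 0 \<or> bc s' *\<^sub>v w = 0\<^sub>v (dim_row (bc s'))" if "(x, y) \<in> side_points s'" for x y s'
      using that ker South by (cases s') auto
    from test[OF bump_deriv d0[of n] continuous_on_bump_deriv c0 this] show ?thesis
      using South B w by (simp add: I0 mult_ac)
  next
    case East
    have "p1 n x * bump y = 0 \<or> bc s' *\<^sub>v w = 0\<^sub>v (dim_row (bc s'))" if "(x, y) \<in> side_points s'" for x y s'
      using that ker East by (cases s') auto
    from test[OF d1[of n] bump_deriv c1 continuous_on_bump_deriv this] show ?thesis
      using East by (simp add: I1 mult_ac)
  next
    case North
    have "bump x * p1 n y = 0 \<or> bc s' *\<^sub>v w = 0\<^sub>v (dim_row (bc s'))" if "(x, y) \<in> side_points s'" for x y s'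
      using that ker North by (cases s') auto
    from test[OF bump_deriv d1[of n] continuous_on_bump_deriv c1 this] show ?thesis
      using North by (simp add: I1 mult_ac)
  next
    case West
    have "p0 n x * bump y = 0 \<or> bc s' *\<^sub>v w = 0\<^sub>v (dim_row (bc s'))" if "(x, y) \<in> side_points s'" for x y s'
      using that ker West by (cases s') auto
    from test[OF d0[of n] bump_deriv c0 continuous_on_bump_deriv this] show ?thesis
      using West A w by (simp add: I0 mult_ac)
  qed
  then have "?I * (- ?X / 2) \<le> ?I * (\<alpha> * (w \<bullet> w) * (1 / (2 * real n + 3)))" for n
    by (simp only: mult_ac)
  then have le: "- ?X / 2 \<le> \<alpha> * (w \<bullet> w) * (1 / (2 * real n + 3))" for n
    using integral_bump_square_pos by (simp only: mult_le_cancel_left_pos)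
  have "(\<lambda>n. \<alpha> * (w \<bullet> w) * (1 / (2 * real n + 3))) \<longlonglongrightarrow> \<alpha> * (w \<bullet> w) * 0"
  proof (intro tendsto_intros)
    have "filterlim (\<lambda>n. 3 + real n * 2) at_top sequentially"
      by (intro filterlim_tendsto_add_at_top[OF tendsto_const] filterlim_at_top_mult_tendsto_pos[OF tendsto_const])
        (auto simp: filterlim_real_sequentially)
    then show "(\<lambda>n. 1 / (2 * real n + 3)) \<longlonglongrightarrow> 0"
      by (intro real_tendsto_divide_at_top[OF tendsto_const]) (simp add: add.commute mult.commute)
  qed
  then have "- ?X / 2 \<le> \<alpha> * (w \<bullet> w) * 0"
    by (rule LIMSEQ_le_const) (use le in blast)
  then show ?thesis by simp
qed

section \<open>Boundary terms of the difference operators\<close>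

lemma scalar_prod_transpose_mult:
  fixes W :: "real mat"
  assumes "W \<in> carrier_mat m n" "w \<in> carrier_vec n" "u \<in> carrier_vec m"
  shows "w \<bullet> (W\<^sup>T *\<^sub>v u) = (W *\<^sub>v w) \<bullet> u"
  using transpose_vec_mult_scalar[of "W\<^sup>T" n m u w] assms by simp

lemma congruence_form:
  fixes W Y :: "real mat"
  assumes W: "W \<in> carrier_mat m n" and Y: "Y \<in> carrier_mat m m" and w: "w \<in> carrier_vec n"
  shows "w \<bullet> ((W\<^sup>T * (Y * W)) *\<^sub>v w) = (W *\<^sub>v w) \<bullet> (Y *\<^sub>v (W *\<^sub>v w))"
proof -
  have "(W\<^sup>T * (Y * W)) *\<^sub>v w = W\<^sup>T *\<^sub>v (Y *\<^sub>v (W *\<^sub>v w))"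
    using assoc_mult_mat_vec[of "W\<^sup>T" n m "Y * W" n w] assoc_mult_mat_vec[OF Y W w] W Y w by simp
  then show ?thesis using assms by (simp add: scalar_prod_transpose_mult[of W m n])
qed

text \<open>The form is the congruence of \<open>H \<otimes>\<^sub>K A\<close> under the restriction \<open>W\<close> to one side, and the boundary
  condition factors through \<open>W\<close>. Here the restriction \<open>e\<close> acts on the inner index \<open>i\<close>, which is the
  case of the sides \<open>East\<close> and \<open>West\<close>; \<open>outer_side_form_nonneg\<close> is the same for \<open>South\<close> and
  \<open>North\<close>.\<close>

lemma inner_side_form_nonneg:
  assumes e: "e \<in> carrier_mat 1 m" and H: "spd n H" and A: "A \<in> carrier_mat d d"
    and M: "M \<in> carrier_mat r d"
    and nonneg: "\<And>x. x \<in> carrier_vec d \<Longrightarrow> M *\<^sub>v x = 0\<^sub>v r \<Longrightarrow> x \<bullet> (A *\<^sub>v x) \<ge> 0"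
    and w: "w \<in> carrier_vec (n * (m * d))" and Mw: "(1\<^sub>m n \<otimes>\<^sub>K e \<otimes>\<^sub>K M) *\<^sub>v w = 0\<^sub>v (n * r)"
  shows "w \<bullet> ((H \<otimes>\<^sub>K (e\<^sup>T * e) \<otimes>\<^sub>K A) *\<^sub>v w) \<ge> 0"
proof -
  define W where "W = 1\<^sub>m n \<otimes>\<^sub>K e \<otimes>\<^sub>K 1\<^sub>m d"
  have Hc: "H \<in> carrier_mat n n" using H by (simp add: spd_def symmetric_mat_def)
  have W: "W \<in> carrier_mat (n * d) (n * (m * d))" using e by (auto simp: W_def)
  have HA: "H \<otimes>\<^sub>K A \<in> carrier_mat (n * d) (n * d)" using Hc A by auto
  \<comment> \<open>A factor \<open>1\<^sub>m 1\<close> in the middle turns \<open>1\<^sub>m n \<otimes>\<^sub>K M\<close> into a threefold product matching \<open>W\<close>.\<close>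
  have "(1\<^sub>m n \<otimes>\<^sub>K M) * W = 1\<^sub>m n \<otimes>\<^sub>K e \<otimes>\<^sub>K M"
    using e M kron_mult[of "1\<^sub>m n" "1\<^sub>m n" "1\<^sub>m 1 \<otimes>\<^sub>K M" "e \<otimes>\<^sub>K 1\<^sub>m d"] kron_mult[of "1\<^sub>m 1" e M "1\<^sub>m d"]
    by (simp add: W_def)
  then have "(1\<^sub>m n \<otimes>\<^sub>K M) *\<^sub>v (W *\<^sub>v w) = 0\<^sub>v (n * r)"
    using Mw W M w by (subst assoc_mult_mat_vec[symmetric, of _ "n * r" "n * d"]) auto
  then have "0 \<le> (W *\<^sub>v w) \<bullet> ((H \<otimes>\<^sub>K A) *\<^sub>v (W *\<^sub>v w))"
    using kron_form_nonneg[OF H A M nonneg, of "W *\<^sub>v w"] W w by simp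
  also have "\<dots> = w \<bullet> ((W\<^sup>T * ((H \<otimes>\<^sub>K A) * W)) *\<^sub>v w)"
    by (rule congruence_form[OF W HA w, symmetric])
  also have "W\<^sup>T * ((H \<otimes>\<^sub>K A) * W) = H \<otimes>\<^sub>K (e\<^sup>T * e) \<otimes>\<^sub>K A"
  proof -
    have "(H \<otimes>\<^sub>K A) * W = H \<otimes>\<^sub>K e \<otimes>\<^sub>K A"
      using e A Hc kron_mult[of H "1\<^sub>m n" "1\<^sub>m 1 \<otimes>\<^sub>K A" "e \<otimes>\<^sub>K 1\<^sub>m d"] kron_mult[of "1\<^sub>m 1" e A "1\<^sub>m d"]
      by (simp add: W_def)
    then show ?thesis using e A Hc by (simp add: W_def transpose_kron kron_mult)
  qed
  finally show ?thesis .
qed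

lemma outer_side_form_nonneg:
  assumes e: "e \<in> carrier_mat 1 m" and H: "spd n H" and A: "A \<in> carrier_mat d d"
    and M: "M \<in> carrier_mat r d"
    and nonneg: "\<And>x. x \<in> carrier_vec d \<Longrightarrow> M *\<^sub>v x = 0\<^sub>v r \<Longrightarrow> x \<bullet> (A *\<^sub>v x) \<ge> 0"
    and w: "w \<in> carrier_vec (m * (n * d))" and Mw: "(e \<otimes>\<^sub>K 1\<^sub>m n \<otimes>\<^sub>K M) *\<^sub>v w = 0\<^sub>v (n * r)"
  shows "w \<bullet> (((e\<^sup>T * e) \<otimes>\<^sub>K H \<otimes>\<^sub>K A) *\<^sub>v w) \<ge> 0"
proof -
  define W where "W = e \<otimes>\<^sub>K 1\<^sub>m n \<otimes>\<^sub>K 1\<^sub>m d"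
  have Hc: "H \<in> carrier_mat n n" using H by (simp add: spd_def symmetric_mat_def)
  have W: "W \<in> carrier_mat (n * d) (m * (n * d))" using e by (auto simp: W_def)
  have HA: "H \<otimes>\<^sub>K A \<in> carrier_mat (n * d) (n * d)" using Hc A by auto
  have "(1\<^sub>m n \<otimes>\<^sub>K M) * W = e \<otimes>\<^sub>K 1\<^sub>m n \<otimes>\<^sub>K M"
    using e M kron_mult[of "1\<^sub>m 1" e "1\<^sub>m n \<otimes>\<^sub>K M" "1\<^sub>m n \<otimes>\<^sub>K 1\<^sub>m d"]
    by (simp add: W_def kron_mult)
  then have "(1\<^sub>m n \<otimes>\<^sub>K M) *\<^sub>v (W *\<^sub>v w) = 0\<^sub>v (n * r)"
    using Mw W M w by (subst assoc_mult_mat_vec[symmetric, of _ "n * r" "n * d"]) auto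
  then have "0 \<le> (W *\<^sub>v w) \<bullet> ((H \<otimes>\<^sub>K A) *\<^sub>v (W *\<^sub>v w))"
    using kron_form_nonneg[OF H A M nonneg, of "W *\<^sub>v w"] W w by simp
  also have "\<dots> = w \<bullet> ((W\<^sup>T * ((H \<otimes>\<^sub>K A) * W)) *\<^sub>v w)"
    by (rule congruence_form[OF W HA w, symmetric])
  also have "W\<^sup>T * ((H \<otimes>\<^sub>K A) * W) = (e\<^sup>T * e) \<otimes>\<^sub>K H \<otimes>\<^sub>K A"
  proof -
    have "(H \<otimes>\<^sub>K A) * W = e \<otimes>\<^sub>K H \<otimes>\<^sub>K A"
      using e A Hc kron_mult[of "1\<^sub>m 1" e "H \<otimes>\<^sub>K A" "1\<^sub>m n \<otimes>\<^sub>K 1\<^sub>m d"]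
      by (simp add: W_def kron_mult)
    then show ?thesis using e A Hc by (simp add: W_def transpose_kron kron_mult)
  qed
  finally show ?thesis .
qed

lemma dim_id_row [simp]: "dim_row (id_row n k) = 1" "dim_col (id_row n k) = n"
  by (simp_all add: id_row_def)

lemma id_row_carrier [simp]: "id_row n k \<in> carrier_mat 1 n"
  by (rule carrier_matI) simp_all

lemma sbp_matrix:
  assumes H: "symmetric_mat (N + 1) H" and D: "D \<in> carrier_mat (N + 1) (N + 1)" and sbp: "sbp N H D"
  shows "H * D + D\<^sup>T * H =
    (id_row (N + 1) N)\<^sup>T * id_row (N + 1) N - (id_row (N + 1) 0)\<^sup>T * id_row (N + 1) 0"
proof (rule eq_matI)
  let ?n = "N + 1"
  have Hc: "H \<in> carrier_mat ?n ?n" using H by (simp add: symmetric_mat_def)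
  fix i j
  assume "i < dim_row ((id_row ?n N)\<^sup>T * id_row ?n N - (id_row ?n 0)\<^sup>T * id_row ?n 0)"
    and "j < dim_col ((id_row ?n N)\<^sup>T * id_row ?n N - (id_row ?n 0)\<^sup>T * id_row ?n 0)"
  then have i: "i < ?n" and j: "j < ?n" by (simp_all add: id_row_def)
  let ?a = "unit_vec ?n i :: real vec" and ?b = "unit_vec ?n j :: real vec"
  have entry: "?a \<bullet> (M *\<^sub>v ?b) = M $$ (i, j)" if M: "M \<in> carrier_mat ?n ?n" for M :: "real mat"
  proof -
    have "?a \<bullet> (M *\<^sub>v ?b) = (M *\<^sub>v ?b) $ i"
      using M i by (intro scalar_prod_left_unit) auto
    also have "\<dots> = M $$ (i, j)" using M i j by simp
    finally show ?thesis .
  qed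
  have "?a \<bullet> (H *\<^sub>v (D *\<^sub>v ?b)) + (D *\<^sub>v ?a) \<bullet> (H *\<^sub>v ?b) = ?a $ N * ?b $ N - ?a $ 0 * ?b $ 0"
    using sbp by (simp add: sbp_def)
  moreover have "?a \<bullet> (H *\<^sub>v (D *\<^sub>v ?b)) = (H * D) $$ (i, j)"
    using entry[of "H * D"] Hc D by (simp add: assoc_mult_mat_vec[of _ ?n ?n])
  moreover have "(D *\<^sub>v ?a) \<bullet> (H *\<^sub>v ?b) = (D\<^sup>T * H) $$ (i, j)"
    using entry[of "D\<^sup>T * H"] Hc D
    by (simp add: assoc_mult_mat_vec[of _ ?n ?n] scalar_prod_transpose_mult[of D ?n ?n])
  moreover have "((id_row ?n k)\<^sup>T * id_row ?n k) $$ (i, j) = ?a $ k * ?b $ k" if "k < ?n" for k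
    using that i j by (simp add: id_row_def scalar_prod_def)
  ultimately show "(H * D + D\<^sup>T * H) $$ (i, j) =
      ((id_row ?n N)\<^sup>T * id_row ?n N - (id_row ?n 0)\<^sup>T * id_row ?n 0) $$ (i, j)"
    using i j Hc D by (simp add: id_row_def)
qed (use H D in \<open>auto simp: symmetric_mat_def\<close>)

lemma two_form_eq_symmetric_part:
  fixes K :: "real mat"
  assumes K: "K \<in> carrier_mat n n" and w: "w \<in> carrier_vec n"
  shows "2 * (w \<bullet> (K *\<^sub>v w)) = w \<bullet> ((K + K\<^sup>T) *\<^sub>v w)"
proof -
  have "w \<bullet> ((K + K\<^sup>T) *\<^sub>v w) = w \<bullet> (K *\<^sub>v w) + w \<bullet> (K\<^sup>T *\<^sub>v w)"
    using assms by (simp add: add_mult_distrib_mat_vec[of _ n n] scalar_prod_add_distrib[of _ n])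
  also have "w \<bullet> (K\<^sup>T *\<^sub>v w) = w \<bullet> (K *\<^sub>v w)"
    using assms by (simp add: scalar_prod_transpose_mult[of K n n] comm_scalar_prod[of _ n])
  finally show ?thesis by simp
qed

lemma form_diff:
  fixes K :: "real mat"
  assumes "K \<in> carrier_mat n n" "K' \<in> carrier_mat n n" "w \<in> carrier_vec n"
  shows "w \<bullet> ((K - K') *\<^sub>v w) = w \<bullet> (K *\<^sub>v w) - w \<bullet> (K' *\<^sub>v w)"
  using assms
  by (simp add: minus_mult_distrib_mat_vec[of _ n n] scalar_prod_minus_distrib[of _ n])

lemma kron_uminus_right: "X \<otimes>\<^sub>K (- Y) = - (X \<otimes>\<^sub>K Y)"
  by (rule eq_matI) (auto simp: index_kron div_mod_less_mult)

lemma form_uminus: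
  fixes K :: "real mat"
  assumes "K \<in> carrier_mat n n" "w \<in> carrier_vec n"
  shows "w \<bullet> ((- K) *\<^sub>v w) = - (w \<bullet> (K *\<^sub>v w))"
  using assms by (simp add: scalar_prod_mult_mat_vec_sum[of _ n n] sum_negf)

text \<open>The symmetric part of \<open>H2 \<otimes>\<^sub>K (H1 * D) \<otimes>\<^sub>K A\<close> lives on the two sides \<open>i = N\<close> and \<open>i = 0\<close>. The
  sign of the second boundary term is moved into \<open>- A\<close>, the symbol for the outward normal at
  \<open>i = 0\<close>.\<close>

lemma sbp_form_inner:
  assumes H1: "symmetric_mat (N + 1) H1" and D: "D \<in> carrier_mat (N + 1) (N + 1)" and sbp: "sbp N H1 D"
    and H2: "symmetric_mat m H2" and A: "symmetric_mat d A"
    and w: "w \<in> carrier_vec (m * ((N + 1) * d))"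
  defines "E \<equiv> \<lambda>k. (id_row (N + 1) k)\<^sup>T * id_row (N + 1) k"
  shows "2 * (w \<bullet> ((H2 \<otimes>\<^sub>K (H1 * D) \<otimes>\<^sub>K A) *\<^sub>v w)) =
    w \<bullet> ((H2 \<otimes>\<^sub>K E N \<otimes>\<^sub>K A) *\<^sub>v w) + w \<bullet> ((H2 \<otimes>\<^sub>K E 0 \<otimes>\<^sub>K (- A)) *\<^sub>v w)"
proof -
  let ?n = "N + 1"
  have c: "H1 \<in> carrier_mat ?n ?n" "H2 \<in> carrier_mat m m" "A \<in> carrier_mat d d"
    and t: "H1\<^sup>T = H1" "H2\<^sup>T = H2" "A\<^sup>T = A"
    using H1 H2 A by (auto simp: symmetric_mat_def)
  have E: "E k \<in> carrier_mat ?n ?n" for k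
    using id_row_carrier[of ?n k] by (simp add: E_def)
  have KE: "H2 \<otimes>\<^sub>K E k \<otimes>\<^sub>K A \<in> carrier_mat (m * (?n * d)) (m * (?n * d))" for k
    using c E by (intro kron_carrier)
  let ?K = "H2 \<otimes>\<^sub>K (H1 * D) \<otimes>\<^sub>K A"
  have K: "?K \<in> carrier_mat (m * (?n * d)) (m * (?n * d))"
    using c D by (intro kron_carrier) auto
  have "?K\<^sup>T = H2 \<otimes>\<^sub>K (D\<^sup>T * H1) \<otimes>\<^sub>K A"
    using c D t by (simp add: transpose_kron transpose_mult[of _ ?n ?n])
  then have "?K + ?K\<^sup>T = H2 \<otimes>\<^sub>K (H1 * D + D\<^sup>T * H1) \<otimes>\<^sub>K A"
    using c D by (simp add: kron_add_distrib)
  also have "\<dots> = H2 \<otimes>\<^sub>K E N \<otimes>\<^sub>K A - H2 \<otimes>\<^sub>K E 0 \<otimes>\<^sub>K A"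
    unfolding sbp_matrix[OF H1 D sbp] by (simp add: E_def kron_diff_distrib)
  finally show ?thesis
    by (simp add: two_form_eq_symmetric_part[OF K w] form_diff[OF KE KE w] kron_uminus_right form_uminus[OF KE w])
qed

lemma sbp_form_outer:
  assumes H2: "symmetric_mat (N + 1) H2" and D: "D \<in> carrier_mat (N + 1) (N + 1)" and sbp: "sbp N H2 D"
    and H1: "symmetric_mat m H1" and A: "symmetric_mat d A"
    and w: "w \<in> carrier_vec ((N + 1) * (m * d))"
  defines "E \<equiv> \<lambda>k. (id_row (N + 1) k)\<^sup>T * id_row (N + 1) k"
  shows "2 * (w \<bullet> (((H2 * D) \<otimes>\<^sub>K H1 \<otimes>\<^sub>K A) *\<^sub>v w)) =
    w \<bullet> ((E N \<otimes>\<^sub>K H1 \<otimes>\<^sub>K A) *\<^sub>v w) + w \<bullet> ((E 0 \<otimes>\<^sub>K H1 \<otimes>\<^sub>K (- A)) *\<^sub>v w)"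
proof -
  let ?n = "N + 1"
  have c: "H2 \<in> carrier_mat ?n ?n" "H1 \<in> carrier_mat m m" "A \<in> carrier_mat d d"
    and t: "H1\<^sup>T = H1" "H2\<^sup>T = H2" "A\<^sup>T = A"
    using H1 H2 A by (auto simp: symmetric_mat_def)
  have E: "E k \<in> carrier_mat ?n ?n" for k
    using id_row_carrier[of ?n k] by (simp add: E_def)
  have KE: "E k \<otimes>\<^sub>K H1 \<otimes>\<^sub>K A \<in> carrier_mat (?n * (m * d)) (?n * (m * d))" for k
    using c E by (intro kron_carrier)
  let ?K = "(H2 * D) \<otimes>\<^sub>K H1 \<otimes>\<^sub>K A"
  have K: "?K \<in> carrier_mat (?n * (m * d)) (?n * (m * d))"
    using c D by (intro kron_carrier) auto
  have "?K\<^sup>T = (D\<^sup>T * H2) \<otimes>\<^sub>K H1 \<otimes>\<^sub>K A"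
    using c D t by (simp add: transpose_kron transpose_mult[of _ ?n ?n])
  then have "?K + ?K\<^sup>T = (H2 * D + D\<^sup>T * H2) \<otimes>\<^sub>K H1 \<otimes>\<^sub>K A"
    using c D by (simp add: kron_add_distrib)
  also have "\<dots> = E N \<otimes>\<^sub>K H1 \<otimes>\<^sub>K A - E 0 \<otimes>\<^sub>K H1 \<otimes>\<^sub>K A"
    unfolding sbp_matrix[OF H2 D sbp] by (simp add: E_def kron_diff_distrib)
  finally show ?thesis
    by (simp add: two_form_eq_symmetric_part[OF K w] form_diff[OF KE KE w] kron_uminus_right form_uminus[OF KE w])
qed

section \<open>The kernel of the discrete boundary operator\<close>

lemma append_rows_mult_eq_zero:
  fixes X Y :: "real mat"
  assumes X: "X \<in> carrier_mat a n" and Y: "Y \<in> carrier_mat b n" and v: "v \<in> carrier_vec n"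
    and zero: "(X @\<^sub>r Y) *\<^sub>v v = 0\<^sub>v (a + b)"
  shows "X *\<^sub>v v = 0\<^sub>v a" "Y *\<^sub>v v = 0\<^sub>v b"
proof -
  have "(X *\<^sub>v v) @\<^sub>v (Y *\<^sub>v v) = 0\<^sub>v a @\<^sub>v 0\<^sub>v b"
  proof -
    have "0\<^sub>v a @\<^sub>v 0\<^sub>v b = (0\<^sub>v (a + b) :: real vec)" by auto
    then show ?thesis using mat_mult_append[OF X Y v] zero by simp
  qed
  then have "X *\<^sub>v v = 0\<^sub>v a \<and> Y *\<^sub>v v = 0\<^sub>v b"
    using append_vec_eq[of "X *\<^sub>v v" a "0\<^sub>v a" "Y *\<^sub>v v" "0\<^sub>v b"] X v by simp
  then show "X *\<^sub>v v = 0\<^sub>v a" "Y *\<^sub>v v = 0\<^sub>v b" by auto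
qed

lemma pad_rows_carrier:
  assumes "dim_row M \<le> d" "dim_col M = n"
  shows "pad_rows d M \<in> carrier_mat d n"
proof -
  have "M @\<^sub>r 0\<^sub>m (d - dim_row M) n \<in> carrier_mat (dim_row M + (d - dim_row M)) n"
    using assms by (intro carrier_append_rows carrier_matI) simp_all
  then show ?thesis using assms by (simp add: pad_rows_def)
qed

lemma pad_rows_kernel:
  assumes "dim_row M \<le> d" "v \<in> carrier_vec (dim_col M)" "pad_rows d M *\<^sub>v v = 0\<^sub>v d"
  shows "M *\<^sub>v v = 0\<^sub>v (dim_row M)"
proof (rule append_rows_mult_eq_zero(1))
  show "M \<in> carrier_mat (dim_row M) (dim_col M)" by (rule carrier_matI) simp_all
  show "0\<^sub>m (d - dim_row M) (dim_col M) \<in> carrier_mat (d - dim_row M) (dim_col M)" by simp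
  show "(M @\<^sub>r 0\<^sub>m (d - dim_row M) (dim_col M)) *\<^sub>v v = 0\<^sub>v (dim_row M + (d - dim_row M))"
    using assms by (simp add: pad_rows_def)
qed (rule assms)

lemma boundary_op_kernel:
  fixes bc :: "side \<Rightarrow> real mat" and N1 N2 :: nat
  assumes bc: "\<And>s. dim_row (bc s) \<le> d" "\<And>s. dim_col (bc s) = d"
  defines "n1 \<equiv> N1 + 1" and "n2 \<equiv> N2 + 1" and "M \<equiv> \<lambda>s. pad_rows d (bc s)"
  shows boundary_op_carrier: "boundary_op d N1 N2 bc \<in> carrier_mat ((n1 + (n2 + (n1 + n2))) * d) (n2 * (n1 * d))"
    and "\<And>w. w \<in> carrier_vec (n2 * (n1 * d)) \<Longrightarrow>
      boundary_op d N1 N2 bc *\<^sub>v w = 0\<^sub>v ((n1 + (n2 + (n1 + n2))) * d) \<Longrightarrow>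
      (id_row n2 0 \<otimes>\<^sub>K 1\<^sub>m n1 \<otimes>\<^sub>K M South) *\<^sub>v w = 0\<^sub>v (n1 * d) \<and>
      (1\<^sub>m n2 \<otimes>\<^sub>K id_row n1 N1 \<otimes>\<^sub>K M East) *\<^sub>v w = 0\<^sub>v (n2 * d) \<and>
      (id_row n2 N2 \<otimes>\<^sub>K 1\<^sub>m n1 \<otimes>\<^sub>K M North) *\<^sub>v w = 0\<^sub>v (n1 * d) \<and>
      (1\<^sub>m n2 \<otimes>\<^sub>K id_row n1 0 \<otimes>\<^sub>K M West) *\<^sub>v w = 0\<^sub>v (n2 * d)"
proof -
  have M: "M s \<in> carrier_mat d d" for s
    unfolding M_def using bc by (intro pad_rows_carrier)
  have outer: "id_row n2 k \<otimes>\<^sub>K 1\<^sub>m n1 \<otimes>\<^sub>K M s \<in> carrier_mat (n1 * d) (n2 * (n1 * d))" for k s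
    using kron_carrier[OF id_row_carrier[of n2 k] kron_carrier[OF one_carrier_mat M]] by simp
  have inner: "1\<^sub>m n2 \<otimes>\<^sub>K id_row n1 k \<otimes>\<^sub>K M s \<in> carrier_mat (n2 * d) (n2 * (n1 * d))" for k s
    using kron_carrier[OF one_carrier_mat kron_carrier[OF id_row_carrier[of n1 k] M]] by simp
  note c3 = carrier_append_rows[OF outer inner]
  note c2 = carrier_append_rows[OF inner c3]
  note c1 = carrier_append_rows[OF outer c2]
  have L: "boundary_op d N1 N2 bc =
      (id_row n2 0 \<otimes>\<^sub>K 1\<^sub>m n1 \<otimes>\<^sub>K M South) @\<^sub>r (1\<^sub>m n2 \<otimes>\<^sub>K id_row n1 N1 \<otimes>\<^sub>K M East) @\<^sub>r
      (id_row n2 N2 \<otimes>\<^sub>K 1\<^sub>m n1 \<otimes>\<^sub>K M North) @\<^sub>r (1\<^sub>m n2 \<otimes>\<^sub>K id_row n1 0 \<otimes>\<^sub>K M West)"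
    by (simp add: boundary_op_def Let_def M_def n1_def n2_def)
  have dim: "(n1 + (n2 + (n1 + n2))) * d = n1 * d + (n2 * d + (n1 * d + n2 * d))"
    by (simp add: algebra_simps)
  show "boundary_op d N1 N2 bc \<in> carrier_mat ((n1 + (n2 + (n1 + n2))) * d) (n2 * (n1 * d))"
    unfolding L dim by (rule c1)
  fix w assume w: "w \<in> carrier_vec (n2 * (n1 * d))"
    and "boundary_op d N1 N2 bc *\<^sub>v w = 0\<^sub>v ((n1 + (n2 + (n1 + n2))) * d)"
  note z1 = append_rows_mult_eq_zero[OF outer c2 w this(2)[unfolded L dim]]
  note z2 = append_rows_mult_eq_zero[OF inner c3 w z1(2)]
  note z3 = append_rows_mult_eq_zero[OF outer inner w z2(2)]
  show "(id_row n2 0 \<otimes>\<^sub>K 1\<^sub>m n1 \<otimes>\<^sub>K M South) *\<^sub>v w = 0\<^sub>v (n1 * d) \<and>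
      (1\<^sub>m n2 \<otimes>\<^sub>K id_row n1 N1 \<otimes>\<^sub>K M East) *\<^sub>v w = 0\<^sub>v (n2 * d) \<and>
      (id_row n2 N2 \<otimes>\<^sub>K 1\<^sub>m n1 \<otimes>\<^sub>K M North) *\<^sub>v w = 0\<^sub>v (n1 * d) \<and>
      (1\<^sub>m n2 \<otimes>\<^sub>K id_row n1 0 \<otimes>\<^sub>K M West) *\<^sub>v w = 0\<^sub>v (n2 * d)"
    using z1(1) z2(1) z3 by simp
qed

text \<open>Discrete counterpart of the energy estimate: on grid vectors that satisfy the boundary conditions
  the spatial operator can only dissipate energy, for full norm matrices as for diagonal ones.\<close>

lemma space_op_form_nonneg:
  fixes bc :: "side \<Rightarrow> real mat"
  assumes A: "symmetric_mat d A" and B: "symmetric_mat d B"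
    and bc: "\<And>s. dim_row (bc s) \<le> d" "\<And>s. dim_col (bc s) = d"
    and nonneg: "\<And>s x. x \<in> carrier_vec d \<Longrightarrow> bc s *\<^sub>v x = 0\<^sub>v (dim_row (bc s)) \<Longrightarrow>
        0 \<le> x \<bullet> (normal_mat A B s *\<^sub>v x)"
    and H1: "spd (N1 + 1) H1" and D1: "D1 \<in> carrier_mat (N1 + 1) (N1 + 1)" and sbp1: "sbp N1 H1 D1"
    and H2: "spd (N2 + 1) H2" and D2: "D2 \<in> carrier_mat (N2 + 1) (N2 + 1)" and sbp2: "sbp N2 H2 D2"
    and w: "w \<in> carrier_vec ((N2 + 1) * ((N1 + 1) * d))"
    and Lw: "boundary_op d N1 N2 bc *\<^sub>v w = 0\<^sub>v (dim_row (boundary_op d N1 N2 bc))"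
  shows "0 \<le> w \<bullet> (gram_V d H1 H2 *\<^sub>v (space_op d N1 N2 A B D1 D2 *\<^sub>v w))"
proof -
  define n1 n2 where "n1 = N1 + 1" and "n2 = N2 + 1"
  define M where "M s = pad_rows d (bc s)" for s
  define E1 E2 where "E1 k = (id_row n1 k)\<^sup>T * id_row n1 k" and "E2 k = (id_row n2 k)\<^sup>T * id_row n2 k" for k
  have s1: "symmetric_mat n1 H1" and s2: "symmetric_mat n2 H2"
    using H1 H2 by (simp_all add: spd_def n1_def n2_def)
  have c: "H1 \<in> carrier_mat n1 n1" "H2 \<in> carrier_mat n2 n2" "A \<in> carrier_mat d d" "B \<in> carrier_mat d d"
    "D1 \<in> carrier_mat n1 n1" "D2 \<in> carrier_mat n2 n2"
    using s1 s2 A B D1 D2 by (auto simp: symmetric_mat_def n1_def n2_def)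
  have M: "M s \<in> carrier_mat d d" for s
    unfolding M_def using bc by (intro pad_rows_carrier)
  have nonneg_pad: "0 \<le> x \<bullet> (normal_mat A B s *\<^sub>v x)" if "x \<in> carrier_vec d" "M s *\<^sub>v x = 0\<^sub>v d" for s x
    using that bc by (intro nonneg pad_rows_kernel) (auto simp: M_def)
  have ker: "boundary_op d N1 N2 bc *\<^sub>v w = 0\<^sub>v ((n1 + (n2 + (n1 + n2))) * d)"
    using Lw boundary_op_carrier[where bc = bc, OF bc, where ?N1.0 = N1 and ?N2.0 = N2] by (simp add: n1_def n2_def)
  have w': "w \<in> carrier_vec (n2 * (n1 * d))" using w by (simp add: n1_def n2_def)
  note zero = boundary_op_kernel(2)[where bc = bc, OF bc, where ?N1.0 = N1 and ?N2.0 = N2, folded n1_def n2_def M_def, OF w' ker]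

  have "0 \<le> w \<bullet> ((H2 \<otimes>\<^sub>K E1 N1 \<otimes>\<^sub>K A) *\<^sub>v w)"
    unfolding E1_def
    by (rule inner_side_form_nonneg[OF id_row_carrier _ c(3) M[of East] _ w'])
      (use H2 zero nonneg_pad[of _ East] in \<open>auto simp: n2_def\<close>)
  moreover have "0 \<le> w \<bullet> ((H2 \<otimes>\<^sub>K E1 0 \<otimes>\<^sub>K (- A)) *\<^sub>v w)"
    unfolding E1_def
    by (rule inner_side_form_nonneg[OF id_row_carrier _ _ M[of West] _ w'])
      (use H2 zero nonneg_pad[of _ West] c in \<open>auto simp: n2_def\<close>)
  moreover have "0 \<le> w \<bullet> ((E2 N2 \<otimes>\<^sub>K H1 \<otimes>\<^sub>K B) *\<^sub>v w)"
    unfolding E2_def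
    by (rule outer_side_form_nonneg[OF id_row_carrier _ c(4) M[of North] _ w'])
      (use H1 zero nonneg_pad[of _ North] in \<open>auto simp: n1_def\<close>)
  moreover have "0 \<le> w \<bullet> ((E2 0 \<otimes>\<^sub>K H1 \<otimes>\<^sub>K (- B)) *\<^sub>v w)"
    unfolding E2_def
    by (rule outer_side_form_nonneg[OF id_row_carrier _ _ M[of South] _ w'])
      (use H1 zero nonneg_pad[of _ South] c in \<open>auto simp: n1_def\<close>)
  moreover note sbp_form_inner[OF s1[unfolded n1_def] D1 sbp1 s2 A w'[unfolded n1_def], folded n1_def]
  moreover note sbp_form_outer[OF s2[unfolded n2_def] D2 sbp2 s1 B w'[unfolded n2_def], folded n2_def]
  moreover have "w \<bullet> (gram_V d H1 H2 *\<^sub>v (space_op d N1 N2 A B D1 D2 *\<^sub>v w)) =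
      w \<bullet> ((H2 \<otimes>\<^sub>K (H1 * D1) \<otimes>\<^sub>K A) *\<^sub>v w) + w \<bullet> (((H2 * D2) \<otimes>\<^sub>K H1 \<otimes>\<^sub>K B) *\<^sub>v w)"
  proof -
    let ?n = "n2 * (n1 * d)"
    have X: "space_op d N1 N2 A B D1 D2 = 1\<^sub>m n2 \<otimes>\<^sub>K D1 \<otimes>\<^sub>K A + D2 \<otimes>\<^sub>K 1\<^sub>m n1 \<otimes>\<^sub>K B"
      unfolding space_op_def Let_def n1_def[symmetric] n2_def[symmetric]
      using c by (simp add: kron_mult)
    have X1: "1\<^sub>m n2 \<otimes>\<^sub>K D1 \<otimes>\<^sub>K A \<in> carrier_mat ?n ?n" and X2: "D2 \<otimes>\<^sub>K 1\<^sub>m n1 \<otimes>\<^sub>K B \<in> carrier_mat ?n ?n"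
      and G: "gram_V d H1 H2 \<in> carrier_mat ?n ?n"
      unfolding gram_V_def using c by auto
    have "gram_V d H1 H2 * (1\<^sub>m n2 \<otimes>\<^sub>K D1 \<otimes>\<^sub>K A) = H2 \<otimes>\<^sub>K (H1 * D1) \<otimes>\<^sub>K A"
      and "gram_V d H1 H2 * (D2 \<otimes>\<^sub>K 1\<^sub>m n1 \<otimes>\<^sub>K B) = (H2 * D2) \<otimes>\<^sub>K H1 \<otimes>\<^sub>K B"
      unfolding gram_V_def using c by (simp_all add: kron_mult)
    then have GX: "gram_V d H1 H2 * space_op d N1 N2 A B D1 D2 = H2 \<otimes>\<^sub>K (H1 * D1) \<otimes>\<^sub>K A + (H2 * D2) \<otimes>\<^sub>K H1 \<otimes>\<^sub>K B"
      unfolding X by (simp add: mult_add_distrib_mat[OF G X1 X2])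
    have K1: "H2 \<otimes>\<^sub>K (H1 * D1) \<otimes>\<^sub>K A \<in> carrier_mat ?n ?n" and K2: "(H2 * D2) \<otimes>\<^sub>K H1 \<otimes>\<^sub>K B \<in> carrier_mat ?n ?n"
      using c by (auto intro!: kron_carrier)
    have "gram_V d H1 H2 *\<^sub>v (space_op d N1 N2 A B D1 D2 *\<^sub>v w) = (gram_V d H1 H2 * space_op d N1 N2 A B D1 D2) *\<^sub>v w"
      using G X1 X2 w' unfolding X by (intro assoc_mult_mat_vec[symmetric]) auto
    also have "\<dots> = (H2 \<otimes>\<^sub>K (H1 * D1) \<otimes>\<^sub>K A) *\<^sub>v w + ((H2 * D2) \<otimes>\<^sub>K H1 \<otimes>\<^sub>K B) *\<^sub>v w"
      unfolding GX by (rule add_mult_distrib_mat_vec[OF K1 K2 w'])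
    finally show ?thesis
      using scalar_prod_add_distrib[OF w' mult_mat_vec_carrier[OF K1 w'] mult_mat_vec_carrier[OF K2 w']] by simp
  qed
  ultimately show ?thesis unfolding E1_def E2_def by linarith
qed

section \<open>The projected semidiscrete system\<close>

text \<open>The derivative of \<open>v \<bullet> G v\<close> along a solution is \<open>- 2 (v \<bullet> G R v)\<close>. The differential equation is
  only available for \<open>t > 0\<close>; continuity carries the monotonicity over to \<open>t = 0\<close>.\<close>

lemma energy_decay:
  assumes G: "symmetric_mat n G" and R: "R \<in> carrier_mat n n"
    and nonneg: "\<And>x. x \<in> carrier_vec n \<Longrightarrow> 0 \<le> x \<bullet> (G *\<^sub>v (R *\<^sub>v x))"
    and sol: "solves n R f v" and "0 \<le> t"
  shows "weighted_norm G (v t) \<le> weighted_norm G f"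
proof -
  have Gc: "G \<in> carrier_mat n n" and Gt: "G\<^sup>T = G" using G by (auto simp: symmetric_mat_def)
  have v: "v t \<in> carrier_vec n" if "0 \<le> t" for t using sol that by (simp add: solves_def)
  have cont: "continuous_on {0..} (\<lambda>t. v t $ k)" if "k < n" for k
    using sol that by (simp add: solves_def)
  have der: "((\<lambda>s. v s $ k) has_real_derivative - ((R *\<^sub>v v t) $ k)) (at t)" if "k < n" "0 < t" for k t
    using sol that by (simp add: solves_def)
  define E where "E t = (\<Sum>i<n. \<Sum>j<n. v t $ i * G $$ (i, j) * v t $ j)" for t
  have E: "E t = v t \<bullet> (G *\<^sub>v v t)" if "0 \<le> t" for t
    unfolding E_def using scalar_prod_mult_mat_vec_sum[OF Gc v v] that by simp
  have "E t \<le> E 0"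
  proof (rule DERIV_nonpos_imp_decreasing_open[OF \<open>0 \<le> t\<close>])
    show "continuous_on {0..t} E"
      unfolding E_def
      by (intro continuous_intros continuous_on_subset[OF cont]) auto
    fix s :: real assume "0 < s"
    then have vs: "v s \<in> carrier_vec n" and Rv: "R *\<^sub>v v s \<in> carrier_vec n"
      using v R by auto
    have "(E has_real_derivative (\<Sum>i<n. \<Sum>j<n.
        - ((R *\<^sub>v v s) $ i * G $$ (i, j) * v s $ j) - v s $ i * G $$ (i, j) * (R *\<^sub>v v s) $ j)) (at s)"
      unfolding E_def
    proof (intro DERIV_sum)
      fix i j assume "i \<in> {..<n}" "j \<in> {..<n}"
      then show "((\<lambda>t. v t $ i * G $$ (i, j) * v t $ j) has_real_derivative
          - ((R *\<^sub>v v s) $ i * G $$ (i, j) * v s $ j) - v s $ i * G $$ (i, j) * (R *\<^sub>v v s) $ j) (at s)"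
        using \<open>0 < s\<close> by (auto intro!: derivative_eq_intros der)
    qed
    also have "(\<Sum>i<n. \<Sum>j<n.
        - ((R *\<^sub>v v s) $ i * G $$ (i, j) * v s $ j) - v s $ i * G $$ (i, j) * (R *\<^sub>v v s) $ j) =
        - ((R *\<^sub>v v s) \<bullet> (G *\<^sub>v v s)) - v s \<bullet> (G *\<^sub>v (R *\<^sub>v v s))"
      by (simp add: scalar_prod_mult_mat_vec_sum[OF Gc] vs Rv sum_subtractf sum_negf)
    also have "(R *\<^sub>v v s) \<bullet> (G *\<^sub>v v s) = v s \<bullet> (G *\<^sub>v (R *\<^sub>v v s))"
      using scalar_prod_transpose_mult[OF Gc vs Rv] Gt Gc vs Rv
      by (simp add: comm_scalar_prod[of _ n])
    finally have "(E has_real_derivative - (v s \<bullet> (G *\<^sub>v (R *\<^sub>v v s))) - v s \<bullet> (G *\<^sub>v (R *\<^sub>v v s))) (at s)" .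
    moreover have "- (v s \<bullet> (G *\<^sub>v (R *\<^sub>v v s))) - v s \<bullet> (G *\<^sub>v (R *\<^sub>v v s)) \<le> 0"
      using nonneg[OF vs] by simp
    ultimately show "\<exists>y. DERIV E s :> y \<and> y \<le> 0" by blast
  qed
  moreover have "v 0 = f" using sol by (simp add: solves_def)
  ultimately show ?thesis
    using E[of 0] E[OF \<open>0 \<le> t\<close>] by (simp add: weighted_norm_def)
qed

lemma projection_mult_vec:
  assumes L: "L \<in> carrier_mat m n" and X: "X \<in> carrier_mat n m" and x: "x \<in> carrier_vec n"
  shows "projection L X *\<^sub>v x = x - (X * L) *\<^sub>v x"
  using assms minus_mult_distrib_mat_vec[of "1\<^sub>m n" n n "X * L" x] by (simp add: projection_def)

lemma projection_self_adjoint: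
  assumes G: "G \<in> carrier_mat n n" and L: "L \<in> carrier_mat m n" and X: "X \<in> carrier_mat n m"
    and sa: "self_adjoint_wrt G (X * L)"
    and x: "x \<in> carrier_vec n" and y: "y \<in> carrier_vec n"
  shows "x \<bullet> (G *\<^sub>v (projection L X *\<^sub>v y)) = (projection L X *\<^sub>v x) \<bullet> (G *\<^sub>v y)"
proof -
  have Ty: "(X * L) *\<^sub>v y \<in> carrier_vec n" and Tx: "(X * L) *\<^sub>v x \<in> carrier_vec n"
    using L X x y by auto
  have "x \<bullet> (G *\<^sub>v (projection L X *\<^sub>v y)) = x \<bullet> (G *\<^sub>v y) - x \<bullet> (G *\<^sub>v ((X * L) *\<^sub>v y))"
    unfolding projection_mult_vec[OF L X y] using G x y Ty
    by (simp add: mult_minus_distrib_mat_vec[OF G] scalar_prod_minus_distrib[of _ n])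
  also have "x \<bullet> (G *\<^sub>v ((X * L) *\<^sub>v y)) = ((X * L) *\<^sub>v x) \<bullet> (G *\<^sub>v y)"
    using sa G x y by (simp add: self_adjoint_wrt_def)
  also have "x \<bullet> (G *\<^sub>v y) - ((X * L) *\<^sub>v x) \<bullet> (G *\<^sub>v y) = (projection L X *\<^sub>v x) \<bullet> (G *\<^sub>v y)"
    unfolding projection_mult_vec[OF L X x] using G x y Tx
    by (simp add: minus_scalar_prod_distrib[of _ n])
  finally show ?thesis .
qed

lemma projection_in_kernel:
  assumes L: "L \<in> carrier_mat m n" and X: "X \<in> carrier_mat n m" and LXL: "L * X * L = L"
    and x: "x \<in> carrier_vec n"
  shows "L *\<^sub>v (projection L X *\<^sub>v x) = 0\<^sub>v m"
proof -
  have XL: "X * L \<in> carrier_mat n n" using L X by auto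
  have "L *\<^sub>v (projection L X *\<^sub>v x) = L *\<^sub>v x - L *\<^sub>v ((X * L) *\<^sub>v x)"
    unfolding projection_mult_vec[OF L X x] using L XL x by (intro mult_minus_distrib_mat_vec) auto
  also have "L *\<^sub>v ((X * L) *\<^sub>v x) = (L * X * L) *\<^sub>v x"
    using assoc_mult_mat_vec[OF L XL x] assoc_mult_mat[OF L X L] by simp
  finally show ?thesis using L x LXL by simp
qed

text \<open>Self-adjointness moves the left factor \<open>P\<close> of \<open>P T P\<close> onto the first argument, so only the values
  of the form of \<open>T\<close> on the range of \<open>P\<close> matter, and this range lies in the kernel of \<open>L\<close>.\<close>

lemma projected_form_nonneg:
  assumes G: "G \<in> carrier_mat n n" and L: "L \<in> carrier_mat m n" and T: "T \<in> carrier_mat n n"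
    and pinv: "is_pseudoinverse G G' L X"
    and nonneg: "\<And>w. w \<in> carrier_vec n \<Longrightarrow> L *\<^sub>v w = 0\<^sub>v m \<Longrightarrow> 0 \<le> w \<bullet> (G *\<^sub>v (T *\<^sub>v w))"
    and x: "x \<in> carrier_vec n"
  defines "P \<equiv> projection L X"
  shows "0 \<le> x \<bullet> (G *\<^sub>v ((P * T * P) *\<^sub>v x))"
proof -
  have X: "X \<in> carrier_mat n m" and LXL: "L * X * L = L" and sa: "self_adjoint_wrt G (X * L)"
    using pinv L by (auto simp: is_pseudoinverse_def)
  have P: "P \<in> carrier_mat n n" using L X by (auto simp: P_def projection_def)
  have Px: "P *\<^sub>v x \<in> carrier_vec n" using P x by auto
  have "(P * T * P) *\<^sub>v x = P *\<^sub>v (T *\<^sub>v (P *\<^sub>v x))"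
    using assoc_mult_mat_vec[of "P * T" n n P n x] assoc_mult_mat_vec[OF P T Px] P T x by simp
  then have "x \<bullet> (G *\<^sub>v ((P * T * P) *\<^sub>v x)) = (P *\<^sub>v x) \<bullet> (G *\<^sub>v (T *\<^sub>v (P *\<^sub>v x)))"
    using projection_self_adjoint[OF G L X sa x, of "T *\<^sub>v (P *\<^sub>v x)"] T Px by (simp add: P_def)
  moreover have "L *\<^sub>v (P *\<^sub>v x) = 0\<^sub>v m"
    unfolding P_def by (rule projection_in_kernel[OF L X LXL x])
  ultimately show ?thesis using nonneg[OF Px] by simp
qed

lemma side_bc_dim:
  assumes "orthogonally_diagonalizes d (Q s) Y"
    and S: "S s \<in> carrier_mat (num_ingoing A B Q s) (d - num_ingoing A B Q s)"
  shows "dim_row (side_bc A B Q S s) \<le> d" "dim_col (side_bc A B Q S s) = d"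
proof -
  let ?I = "ingoing (normal_mat A B s) (Q s)"
  have Q: "Q s \<in> carrier_mat d d" using assms by (simp add: orthogonally_diagonalizes_def)
  have "?I \<subseteq> {..<d}" using Q by (auto simp: ingoing_def)
  then have "card ?I \<le> d" using card_mono[of "{..<d}" ?I] by simp
  then show "dim_row (side_bc A B Q S s) \<le> d"
    using S by (simp add: side_bc_def char_bc_def num_ingoing_def)
  show "dim_col (side_bc A B Q S s) = d"
    using Q by (simp add: side_bc_def char_bc_def Q_out_def dim_submatrix)
qed

section \<open>Strict stability\<close>

theorem proposition78:
  fixes d m1 m2 :: nat
    and A B :: "real mat"
    and Q S bc :: "side \<Rightarrow> real mat"
    and H1 H2 D1 D2 :: "nat \<Rightarrow> real mat"
    and L Lplus P :: "nat \<Rightarrow> nat \<Rightarrow> real mat"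
  defines "bc \<equiv> side_bc A B Q S"
    and "L \<equiv> \<lambda>N1 N2. boundary_op d N1 N2 (side_bc A B Q S)"
    and "P \<equiv> \<lambda>N1 N2. projection (boundary_op d N1 N2 (side_bc A B Q S)) (Lplus N1 N2)"
  assumes "0 < d" and "1 \<le> m1" and "1 \<le> m2"
    and "symmetric_mat d A" and "symmetric_mat d B"
    and "Q South = Q North" and "orthogonally_diagonalizes d (Q South) B"
    and "Q East = Q West" and "orthogonally_diagonalizes d (Q East) A"
    and "\<And>s. S s \<in> carrier_mat (num_ingoing A B Q s) (d - num_ingoing A B Q s)"
    and "semibounded d A B bc"
    and "\<And>N. m1 \<le> N \<Longrightarrow>
           spd (N + 1) (H1 N) \<and> D1 N \<in> carrier_mat (N + 1) (N + 1) \<and> sbp N (H1 N) (D1 N)"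
    and "\<And>N. m2 \<le> N \<Longrightarrow>
           spd (N + 1) (H2 N) \<and> D2 N \<in> carrier_mat (N + 1) (N + 1) \<and> sbp N (H2 N) (D2 N)"
    and "consistent D1" and "consistent D2"
    and "\<And>N1 N2. m1 \<le> N1 \<Longrightarrow> m2 \<le> N2 \<Longrightarrow>
           is_pseudoinverse (gram_V d (H1 N1) (H2 N2)) (gram_boundary d N1 N2 (H1 N1) (H2 N2))
             (L N1 N2) (Lplus N1 N2)"
  shows "strictly_stable (energy_rate d A B bc) {(N1, N2). m1 \<le> N1 \<and> m2 \<le> N2}
           (\<lambda>N1 N2. gram_V d (H1 N1) (H2 N2)) P
           (\<lambda>N1 N2. P N1 N2 * space_op d N1 N2 A B (D1 N1) (D2 N2) * P N1 N2)"
proof -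
  note grid1 = assms(15) and grid2 = assms(16) and pinv = assms(19)
  have A: "symmetric_mat d A" and B: "symmetric_mat d B" by fact+
  then have Ac: "A \<in> carrier_mat d d" and Bc: "B \<in> carrier_mat d d" by (auto simp: symmetric_mat_def)
  have "\<exists>Y. orthogonally_diagonalizes d (Q s) Y" for s
    using assms(9-12) by (cases s) auto
  then have bc: "dim_row (bc s) \<le> d" "dim_col (bc s) = d" for s
    unfolding bc_def using side_bc_dim assms(13) by blast+
  obtain \<alpha> where rate: "energy_rate d A B bc \<alpha>"
    using \<open>semibounded d A B bc\<close> by (auto simp: semibounded_def)
  note nonneg = energy_rate_normal_nonneg[OF rate Ac Bc bc(2)]
  show ?thesis
    unfolding strictly_stable_def
  proof (intro exI[of _ 0] conjI allI impI ballI)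
    show "0 \<le> \<alpha>" if "energy_rate d A B bc \<alpha>" for \<alpha>
      using energy_rate_nonneg[OF that \<open>0 < d\<close> Ac Bc bc(2)] .
    fix g assume "g \<in> {(N1, N2). m1 \<le> N1 \<and> m2 \<le> N2}"
    then obtain N1 N2 where g: "g = (N1, N2)" and N1: "m1 \<le> N1" and N2: "m2 \<le> N2" by auto
    let ?n = "(N2 + 1) * ((N1 + 1) * d)"
    let ?G = "gram_V d (H1 N1) (H2 N2)" and ?T = "space_op d N1 N2 A B (D1 N1) (D2 N2)"
    have H1: "spd (N1 + 1) (H1 N1)" and D1: "D1 N1 \<in> carrier_mat (N1 + 1) (N1 + 1)" and sbp1: "sbp N1 (H1 N1) (D1 N1)"
      using grid1[OF N1] by auto
    have H2: "spd (N2 + 1) (H2 N2)" and D2: "D2 N2 \<in> carrier_mat (N2 + 1) (N2 + 1)" and sbp2: "sbp N2 (H2 N2) (D2 N2)"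
      using grid2[OF N2] by auto
    have Gs: "symmetric_mat ?n ?G"
      unfolding gram_V_def using H1 H2
      by (intro symmetric_mat_kron symmetric_one) (auto simp: spd_def)
    then have G: "?G \<in> carrier_mat ?n ?n" by (simp add: symmetric_mat_def)
    define m where "m = ((N1 + 1) + ((N2 + 1) + ((N1 + 1) + (N2 + 1)))) * d"
    have L: "L N1 N2 \<in> carrier_mat m ?n"
      unfolding L_def bc_def[symmetric] m_def by (rule boundary_op_carrier) (rule bc)+
    have T: "?T \<in> carrier_mat ?n ?n"
      using Ac Bc D1 D2 by (auto simp: space_op_def Let_def)
    have kernel: "0 \<le> w \<bullet> (?G *\<^sub>v (?T *\<^sub>v w))" if "w \<in> carrier_vec ?n" "L N1 N2 *\<^sub>v w = 0\<^sub>v m" for w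
      using that L unfolding L_def bc_def[symmetric]
      by (intro space_op_form_nonneg[OF A B bc nonneg H1 D1 sbp1 H2 D2 sbp2]) auto
    have P: "P N1 N2 = projection (L N1 N2) (Lplus N1 N2)" by (simp add: P_def L_def)
    have Lp: "Lplus N1 N2 \<in> carrier_mat ?n m"
      using pinv[OF N1 N2] L by (auto simp: is_pseudoinverse_def)
    have Pc: "P N1 N2 \<in> carrier_mat ?n ?n"
      unfolding P projection_def using L Lp by auto
    have form: "0 \<le> x \<bullet> (?G *\<^sub>v ((P N1 N2 * ?T * P N1 N2) *\<^sub>v x))" if "x \<in> carrier_vec ?n" for x
      unfolding P using projected_form_nonneg[OF G L T pinv[OF N1 N2] kernel that] .
    have "weighted_norm ?G (v t) \<le> weighted_norm ?G f"
      if "solves (dim_row ?G) (P N1 N2 * ?T * P N1 N2) f v" "0 \<le> t" for f v t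
      using energy_decay[OF Gs _ form] Pc T G that by auto
    then show "case g of (N1, N2) \<Rightarrow> \<forall>f\<in>carrier_vec (dim_row (gram_V d (H1 N1) (H2 N2))). \<forall>v.
        P N1 N2 *\<^sub>v f = f \<longrightarrow>
        solves (dim_row (gram_V d (H1 N1) (H2 N2))) (P N1 N2 * space_op d N1 N2 A B (D1 N1) (D2 N2) * P N1 N2) f v \<longrightarrow>
        (\<forall>t\<ge>0. weighted_norm (gram_V d (H1 N1) (H2 N2)) (v t)
          \<le> exp (0 * t) * weighted_norm (gram_V d (H1 N1) (H2 N2)) f)"
      unfolding g by simp
  qed
qed

end
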